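(* Let $n\ge4$ and consider an edge $\gamma\gamma'$ with inner vertex $\gamma$ and boundary vertex $\gamma'$ in a mesh with $G^1$-smooth piecewise-cubic boundary equipped with the global in-plane parametrisation $\tilde\Pi^{(bicubic)}$. Let values be given for all "central" coefficients $C_0,\dots,C_n$ and for all non-middle "side" coefficients, i.e. $L_j,R_j$ with $j\in\{0,\dots,n\}\setminus\{2,\dots,n'-2\}$, such that Eq(0), Eq(1), Eq($n'+1$) are satisfied, also Eq($n'+2$) is satisfied if $n\ge5$, and, in case $\deg(c)-\max\{\deg(l),\deg(r)\}=2$, the C-equation $\sum_{i=0}^n(-1)^i\binom niC_i=0$ holds. Let $g^{(ij)}=l_ir_j-l_jr_i$. Then the rank of the "Restricted Middle" system $\{\mathrm{Eq}(s):s=2,\dots,n'\}$ in the $2(n'-3)$ side middle unknowns $L_2,\dots,L_{n'-2},R_2,\dots,R_{n'-2}$, and the classification of these unknowns into basic (free) and dependent ones, are as follows. CASE 1: if $g^{(01)}g^{(12)}g^{(02)}\ne0$ and $(g^{(02)})^2=4g^{(01)}g^{(12)}$, then the rank is $n'-2$, and there are $n'-4$ basic and $n'-2$ dependent side middle unknowns. CASE 2: if $g^{(01)}=g^{(12)}=g^{(02)}=0$, then the rank is $n'-3$, and there are $n'-3$ basic and $n'-3$ dependent side middle unknowns; in every pair $(L_t,R_t)$, $t=2,\dots,n'-2$, one is basic and one is dependent. CASE 0: if neither of the previous conditions is satisfied, then the rank is $n'-1$, and there are $n'-5$ basic and $n'-1$ dependent side middle unknowns. (Here a classification into basic and dependent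 unknowns means that the basic ones can be given arbitrary values and the dependent ones are then uniquely determined by the system.)
   Context: $\langle a,b\rangle=a_Xb_Y-a_Yb_X$ for planar vectors. $n'=5$ if $n=4$ and $n'=n$ if $n\ge5$. Geometric setting: two adjacent boundary elements of a planar quadrilateral mesh share the straight edge from the inner vertex $\gamma$ to the boundary vertex $\gamma'$. The right element (relative to $\gamma\to\gamma'$) has vertices $\gamma,\rho,\rho',\gamma'$, the left one $\gamma,\lambda,\lambda',\gamma'$ (cyclic order), forming strictly convex quadrilaterals; the edges $\gamma'\rho'$ and $\gamma'\lambda'$ lie on the boundary of the domain and are cubic B\'ezier curves whose control points next to $\gamma'$ are $T_\rho$ and $T_\lambda$ respectively; the boundary is (non-degenerately) $G^1$-smooth at $\gamma'$, i.e. $\gamma'-T_\lambda$ and $T_\rho-\gamma'$ are nonzero, parallel and of the same direction. The in-plane parametrisation $\tilde\Pi^{(bicubic)}$ (assumed regular: bijective with nowhere vanishing Jacobian on each element) parametrises an element with inner vertices $A,B$ and boundary vertices $C,D$ (cyclic order $A,B,C,D$; $\tilde P(0,0)=A$, $\tilde P(1,0)=B$, $\tilde P(1,1)=C$, $\tilde P(0,1)=D$) and boundary curve control points $D,E,F,C$ by $\tilde P=\sum_{i,j=0}^3\tilde P_{ij}B^3_i(u)B^3_j(v)$, where rows $j=0,1$ and the points $\tilde P_{02},\tilde P_{32}$ come from degree elevation of the bilinear map with corners $A,B,C,D$, $\tilde P_{12}=\frac19(2A+B+C+2D+3E)$, $\tilde P_{22}=\frac19(A+2B+2C+D+3F)$,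 and $\tilde P_{03},\tilde P_{13},\tilde P_{23},\tilde P_{33}=D,E,F,C$. With the left patch having the common edge at $u=1$ and the right one at $u=0$ ($v=0$ at $\gamma$), this gives along the edge: $v$-derivative $\gamma'-\gamma$; $u$-derivative of the left patch $\sum_{i=0}^2a_iB^2_i(v)$ with $a_0=\gamma-\lambda$, $a_1=\frac12[(\gamma-\lambda)+(\gamma'-\lambda')]$, $a_2=3(\gamma'-T_\lambda)$; $u$-derivative of the right patch $\sum_{i=0}^2b_iB^2_i(v)$ with $b_0=\rho-\gamma$, $b_1=\frac12[(\rho-\gamma)+(\rho'-\gamma')]$, $b_2=3(T_\rho-\gamma')$. Weight functions: $l(v)=\sum_{i=0}^2l_iB^2_i(v)$, $r(v)=\sum_{i=0}^2r_iB_i^2(v)$, $c(v)=\sum_{k=0}^4c_kB^4_k(v)$ with $l_i=\langle b_i,\gamma'-\gamma\rangle$, $r_i=-\langle a_i,\gamma'-\gamma\rangle$, $c_k=\binom4k^{-1}\sum_{i+j=k,\,0\le i,j\le2}\binom2i\binom2j\langle a_i,b_j\rangle$. $\deg$ denotes the actual polynomial degree (degree $0$ for the zero polynomial). $Z$ is a degree-$n$ tensor-product B\'ezier polynomial on each element; $C_0,\dots,C_n$ are its coefficients along the edge from $\gamma$ to $\gamma'$; $L_j$, $R_j$ ($0\le j\le n$) those of the neighbouring rows in the left/right element; $\Delta L_j=C_j-L_j$, $\Delta R_j=R_j-C_j$, $\Delta C_j=C_{j+1}-C_j$. Put $$\mathrm{sumLR}_s=\sum_{\substack{i+j=s\\0\le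 i\le n,\,0\le j\le2}}\binom ni\binom2j(l_j\Delta L_i+r_j\Delta R_i),\qquad \mathrm{sumC}_s=\sum_{\substack{i+j=s\\0\le i\le n-1,\,0\le j\le4}}\binom{n-1}i\binom4jc_j\Delta C_i .$$ Eq($s$), $s=0,\dots,n+2$: $\mathrm{sumLR}_s=(-1)^{s+1}\sum_{k=0}^s(-1)^k\mathrm{sumC}_k$. *)

theory Defs
  imports
    "HOL-Analysis.Analysis"
    "HOL-Computational_Algebra.Polynomial"
    "Jordan_Normal_Form.DL_Rank"
begin

type_synonym point = "real \<times> real"

definition cross :: "point \<Rightarrow> point \<Rightarrow> real" where
  "cross a b = fst a * snd b - snd a * fst b"

(* All four turns along the closed polygon A B C D are strict and go the same way. *)
definition strictly_convex_quad :: "point \<Rightarrow> point \<Rightarrow> point \<Rightarrow> point \<Rightarrow> bool" where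
  "strictly_convex_quad A B C D \<longleftrightarrow>
     (0 < cross (B - A) (C - B) \<and> 0 < cross (C - B) (D - C) \<and>
      0 < cross (D - C) (A - D) \<and> 0 < cross (A - D) (B - A)) \<or>
     (cross (B - A) (C - B) < 0 \<and> cross (C - B) (D - C) < 0 \<and>
      cross (D - C) (A - D) < 0 \<and> cross (A - D) (B - A) < 0)"

definition bilinear_map :: "point \<Rightarrow> point \<Rightarrow> point \<Rightarrow> point \<Rightarrow> real \<Rightarrow> real \<Rightarrow> point" where
  "bilinear_map A B C D u v =
     ((1 - u) * (1 - v)) *\<^sub>R A + (u * (1 - v)) *\<^sub>R B + (u * v) *\<^sub>R C + ((1 - u) * v) *\<^sub>R D"

(* Degree elevation of a bilinear map to bidegree (3,3) has its (i,j) control point at the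
   image of (i/3, j/3). *)
definition bicubic_net ::
    "point \<Rightarrow> point \<Rightarrow> point \<Rightarrow> point \<Rightarrow> point \<Rightarrow> point \<Rightarrow> nat \<Rightarrow> nat \<Rightarrow> point" where
  "bicubic_net A B C D E F i j =
     (if j = 3 then (if i = 0 then D else if i = 1 then E else if i = 2 then F else C)
      else if j = 2 \<and> i = 1 then
        (1/9) *\<^sub>R (2 *\<^sub>R A + B + C + 2 *\<^sub>R D + 3 *\<^sub>R E)
      else if j = 2 \<and> i = 2 then
        (1/9) *\<^sub>R (A + 2 *\<^sub>R B + 2 *\<^sub>R C + D + 3 *\<^sub>R F)
      else bilinear_map A B C D (real i / 3) (real j / 3))"

definition bicubic_patch ::
    "point \<Rightarrow> point \<Rightarrow> point \<Rightarrow> point \<Rightarrow> point \<Rightarrow> point \<Rightarrow> real \<Rightarrow> real \<Rightarrow> point" where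
  "bicubic_patch A B C D E F u v =
     (\<Sum>i\<le>3. \<Sum>j\<le>3. (Bernstein 3 i u * Bernstein 3 j v) *\<^sub>R bicubic_net A B C D E F i j)"

definition jacobian :: "(real \<Rightarrow> real \<Rightarrow> point) \<Rightarrow> real \<Rightarrow> real \<Rightarrow> real" where
  "jacobian P u v =
     cross (vector_derivative (\<lambda>x. P x v) (at u)) (vector_derivative (\<lambda>y. P u y) (at v))"

(* The element parametrised by P is the image of the unit square, so that bijectivity onto the
   element is injectivity on the square. *)
definition regular_patch :: "(real \<Rightarrow> real \<Rightarrow> point) \<Rightarrow> bool" where
  "regular_patch P \<longleftrightarrow>
     inj_on (\<lambda>(u, v). P u v) ({0..1} \<times> {0..1}) \<and>
     (\<forall>u\<in>{0..1}. \<forall>v\<in>{0..1}. jacobian P u v \<noteq> 0)"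

(* Quadratic Bezier coefficients, along the common edge from g to g', of the u-derivative of
   the left patch (edge at u = 1, remaining vertices p, p', boundary control point T next to g'),
   respectively of the right patch (edge at u = 0). *)
definition left_deriv :: "point \<Rightarrow> point \<Rightarrow> point \<Rightarrow> point \<Rightarrow> point \<Rightarrow> nat \<Rightarrow> point" where
  "left_deriv g g' p p' T i =
     (if i = 0 then g - p
      else if i = 1 then (1/2) *\<^sub>R ((g - p) + (g' - p'))
      else 3 *\<^sub>R (g' - T))"

definition right_deriv :: "point \<Rightarrow> point \<Rightarrow> point \<Rightarrow> point \<Rightarrow> point \<Rightarrow> nat \<Rightarrow> point" where
  "right_deriv g g' p p' T i =
     (if i = 0 then p - g
      else if i = 1 then (1/2) *\<^sub>R ((p - g) + (p' - g'))
      else 3 *\<^sub>R (T - g'))"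

definition weight_l :: "(nat \<Rightarrow> point) \<Rightarrow> point \<Rightarrow> nat \<Rightarrow> real" where
  "weight_l b e i = cross (b i) e"

definition weight_r :: "(nat \<Rightarrow> point) \<Rightarrow> point \<Rightarrow> nat \<Rightarrow> real" where
  "weight_r a e i = - cross (a i) e"

definition weight_c :: "(nat \<Rightarrow> point) \<Rightarrow> (nat \<Rightarrow> point) \<Rightarrow> nat \<Rightarrow> real" where
  "weight_c a b k =
     (\<Sum>(i, j)\<in>{(i, j). i \<le> 2 \<and> j \<le> 2 \<and> i + j = k}.
        real (2 choose i) * real (2 choose j) * cross (a i) (b j)) / real (4 choose k)"

(* The polynomial with Bezier coefficients w 0, ..., w m. *)
definition bezier_poly :: "nat \<Rightarrow> (nat \<Rightarrow> real) \<Rightarrow> real poly" where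
  "bezier_poly m w =
     (\<Sum>i\<le>m. Polynomial.smult (w i * real (m choose i)) ([:0, 1:] ^ i * [:1, -1:] ^ (m - i)))"

(* Lft j and Rgt j stand for the side coefficients L_j and R_j. *)
datatype side_coeff = Lft nat | Rgt nat

definition sumLR ::
    "nat \<Rightarrow> (nat \<Rightarrow> real) \<Rightarrow> (nat \<Rightarrow> real) \<Rightarrow> (nat \<Rightarrow> real) \<Rightarrow> (side_coeff \<Rightarrow> real) \<Rightarrow> nat \<Rightarrow> real" where
  "sumLR n l r C X s =
     (\<Sum>(i, j)\<in>{(i, j). i \<le> n \<and> j \<le> 2 \<and> i + j = s}.
        real (n choose i) * real (2 choose j) *
        (l j * (C i - X (Lft i)) + r j * (X (Rgt i) - C i)))"

definition sumC :: "nat \<Rightarrow> (nat \<Rightarrow> real) \<Rightarrow> (nat \<Rightarrow> real) \<Rightarrow> nat \<Rightarrow> real" where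
  "sumC n c C s =
     (\<Sum>(i, j)\<in>{(i, j). i \<le> n - 1 \<and> j \<le> 4 \<and> i + j = s}.
        real ((n - 1) choose i) * real (4 choose j) * c j * (C (i + 1) - C i))"

definition Eq ::
    "nat \<Rightarrow> (nat \<Rightarrow> real) \<Rightarrow> (nat \<Rightarrow> real) \<Rightarrow> (nat \<Rightarrow> real) \<Rightarrow> (nat \<Rightarrow> real) \<Rightarrow>
     (side_coeff \<Rightarrow> real) \<Rightarrow> nat \<Rightarrow> bool" where
  "Eq n l r c C X s \<longleftrightarrow>
     sumLR n l r C X s = (-1) ^ (s + 1) * (\<Sum>k\<le>s. (-1) ^ k * sumC n c C k)"

definition nprime :: "nat \<Rightarrow> nat" where
  "nprime n = (if n = 4 then 5 else n)"

definition middle_unknowns :: "nat \<Rightarrow> side_coeff set" where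
  "middle_unknowns n = Lft ` {2..nprime n - 2} \<union> Rgt ` {2..nprime n - 2}"

definition restricted_middle ::
    "nat \<Rightarrow> (nat \<Rightarrow> real) \<Rightarrow> (nat \<Rightarrow> real) \<Rightarrow> (nat \<Rightarrow> real) \<Rightarrow> (nat \<Rightarrow> real) \<Rightarrow>
     (side_coeff \<Rightarrow> real) \<Rightarrow> bool" where
  "restricted_middle n l r c C X \<longleftrightarrow> (\<forall>s\<in>{2..nprime n}. Eq n l r c C X s)"

(* Eq(s) is affine in the side coefficients, which enter only through sumLR, and sumLR is linear
   in (C, X) jointly. So the coefficient of x in Eq(s) is sumLR at C = 0 and the indicator of x.
   Row i of the matrix belongs to Eq(i + 2). *)
definition middle_matrix :: "nat \<Rightarrow> (nat \<Rightarrow> real) \<Rightarrow> (nat \<Rightarrow> real) \<Rightarrow> real mat" where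
  "middle_matrix n l r =
     Matrix.mat (nprime n - 1) (2 * (nprime n - 3))
       (\<lambda>(i, k). sumLR n l r (\<lambda>_. 0)
          (indicator {(map Lft [2..<nprime n - 1] @ map Rgt [2..<nprime n - 1]) ! k})
          (i + 2))"

definition middle_rank :: "nat \<Rightarrow> (nat \<Rightarrow> real) \<Rightarrow> (nat \<Rightarrow> real) \<Rightarrow> nat" where
  "middle_rank n l r = vec_space.rank (nprime n - 1) (middle_matrix n l r)"

(* The middle unknowns split into basic ones, Bas, and dependent ones, Dep, when every choice Y
   of values for the basic unknowns, the non-middle coefficients being those given by G, extends
   to exactly one solution. The values of Y on Dep are irrelevant. *)
definition basic_dependent ::
    "nat \<Rightarrow> (nat \<Rightarrow> real) \<Rightarrow> (nat \<Rightarrow> real) \<Rightarrow> (nat \<Rightarrow> real) \<Rightarrow> (nat \<Rightarrow> real) \<Rightarrow>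
     (side_coeff \<Rightarrow> real) \<Rightarrow> side_coeff set \<Rightarrow> side_coeff set \<Rightarrow> bool" where
  "basic_dependent n l r c C G Bas Dep \<longleftrightarrow>
     Bas \<union> Dep = middle_unknowns n \<and> Bas \<inter> Dep = {} \<and>
     (\<forall>Y. (\<forall>x. x \<notin> middle_unknowns n \<longrightarrow> Y x = G x) \<longrightarrow>
        (\<exists>!X. (\<forall>x. x \<notin> Dep \<longrightarrow> X x = Y x) \<and> restricted_middle n l r c C X))"

end

theory Submission
  imports
    Defs
    "HOL-Computational_Algebra.Polynomial_Factorial"
    "HOL-Computational_Algebra.Field_as_Ring"
begin

text \<open>
  Replace each sequence \<open>w\<close> of Bezier coefficients of degree \<open>m\<close> by the polynomial
  \<open>\<Sum>i\<le>m. (m choose i) * w i * x ^ i\<close>. With \<open>p\<close>, \<open>q\<close> for the quadratics of \<open>l\<close>, \<open>r\<close>, with \<open>c\<close> for the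
  quartic, \<open>\<delta>\<close> for the polynomial of the differences of \<open>C\<close>, and \<open>\<Delta>L\<close>, \<open>\<Delta>R\<close> for those of the side
  differences, the equations say that the coefficients of \<open>p * \<Delta>L + q * \<Delta>R + c * \<delta> / (1 + x)\<close>
  vanish. Up to sign and scaling of the unknowns by binomial coefficients, the matrix of the middle
  system is therefore of Sylvester type: it describes the map
  \<open>(u, v) \<mapsto> p * u + q * v\<close> from pairs of polynomials with \<open>k = nprime n - 3\<close> coefficients to
  polynomials with \<open>k + 2\<close> coefficients. If the gcd \<open>h\<close> of \<open>p\<close> and \<open>q\<close> has degree \<open>d\<close>, the image
  consists of the multiples of \<open>h\<close> there, and the rank is \<open>k + 2 - d = nprime n - 1 - d\<close>.

  The three cases are the three values of \<open>d\<close>: for \<open>d = 2\<close> the quadratics are proportional, and for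
  \<open>d = 1\<close> they are not but their resultant vanishes, which is the equation between the minors \<open>g\<close>
  (\<open>degree_gcd_quadratics\<close>). This uses that \<open>l 0\<close> and \<open>l 2\<close> are nonzero: the first by the position of
  the elements, the second because the Jacobian of the right patch at \<open>\<gamma>'\<close> equals \<open>l 2\<close>
  (\<open>jacobian_bicubic_patch_corner\<close>).

  If \<open>d > 0\<close> the left-hand sides are linearly dependent and consistency is the essential point.
  Here \<open>h\<close> divides \<open>c\<close> because \<open>a\<close>, \<open>b\<close> and the edge direction are three vectors in the plane
  (\<open>common_divisor_dvd_weight_c\<close>). The delicate place is \<open>x = -1\<close>, where the division by \<open>1 + x\<close> takes
  place: there the order of a polynomial measures how far the degree of its Bezier form drops
  (\<open>degree_bezier_poly\<close>), and the C-equation is imposed exactly when \<open>c\<close> alone has no spare root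
  (\<open>gcd_times_linear_dvd\<close>). The residual is thus divisible by \<open>h\<close>; the outer equations cut
  off the coefficients outside the middle range, and \<open>h\<close> is coprime to \<open>x\<close>, so Bezout gives a
  solution (\<open>canonical_basic_dependent\<close>).

  That construction yields one classification into basic and dependent unknowns together with its
  size. Every other classification corresponds to another basis of the column space, so all have
  this size and it is the rank (\<open>middle_rank_eq_card_dependent\<close>).
\<close>

section \<open>Polynomials attached to Bezier coefficients\<close>

text \<open>
  The polynomial \<open>\<Sum>i\<le>m. w i B\<^sup>m\<^sub>i(v)\<close> after the substitution \<open>x = v / (1 - v)\<close> and division by
  \<open>(1 - v) ^ m\<close>. In this form the binomially weighted convolutions in \<open>sumLR\<close>, \<open>sumC\<close> and
  \<open>weight_c\<close> are plain products, and unknown number \<open>t\<close> sits in the coefficient of \<open>x ^ t\<close>.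
\<close>

definition scaled_bernstein :: "nat \<Rightarrow> (nat \<Rightarrow> real) \<Rightarrow> real poly" where
  "scaled_bernstein m w = (\<Sum>i\<le>m. Polynomial.monom (real (m choose i) * w i) i)"

lemma coeff_scaled_bernstein: "poly.coeff (scaled_bernstein m w) i = real (m choose i) * w i"
  by (cases "i \<le> m") (simp_all add: scaled_bernstein_def coeff_sum binomial_eq_0)

lemma degree_scaled_bernstein: "Polynomial.degree (scaled_bernstein m w) \<le> m"
  by (rule degree_le) (simp add: coeff_scaled_bernstein binomial_eq_0)

lemma scaled_bernstein_2: "scaled_bernstein 2 w = [:w 0, 2 * w 1, w 2:]"
  by (rule poly_eqI) (simp add: coeff_scaled_bernstein coeff_pCons numeral_2_eq_2 split: nat.splits)

lemma coeff_mult_scaled_bernstein: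
  "poly.coeff (scaled_bernstein m u * scaled_bernstein k w) s =
     (\<Sum>(i, j)\<in>{(i, j). i \<le> m \<and> j \<le> k \<and> i + j = s}.
        real (m choose i) * real (k choose j) * (u i * w j))"
proof -
  have "poly.coeff (scaled_bernstein m u * scaled_bernstein k w) s =
      (\<Sum>i\<le>s. real (m choose i) * u i * (real (k choose (s - i)) * w (s - i)))"
    by (simp add: coeff_mult coeff_scaled_bernstein)
  also have "\<dots> = (\<Sum>i\<in>{i. i \<le> s \<and> i \<le> m \<and> s - i \<le> k}.
      real (m choose i) * u i * (real (k choose (s - i)) * w (s - i)))"
    by (intro sum.mono_neutral_right) (auto simp: binomial_eq_0)
  also have "\<dots> = (\<Sum>(i, j)\<in>{(i, j). i \<le> m \<and> j \<le> k \<and> i + j = s}.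
        real (m choose i) * real (k choose j) * (u i * w j))"
    by (rule sum.reindex_bij_witness[where i = fst and j = "\<lambda>i. (i, s - i)"]) auto
  finally show ?thesis .
qed

section \<open>The degree of a Bezier polynomial as an order at -1\<close>

text \<open>
  The way back from \<open>x\<close> to \<open>v\<close>: if \<open>f\<close> has degree at most \<open>m\<close>, this is
  \<open>(1 - v) ^ m * f (v / (1 - v))\<close>, written so that it is visibly a polynomial in \<open>v\<close>.
\<close>

definition homogenized :: "nat \<Rightarrow> real poly \<Rightarrow> real poly" where
  "homogenized m f =
     (\<Sum>i\<le>m. Polynomial.smult (poly.coeff f i) ([:0, 1:] ^ i * [:1, -1:] ^ (m - i)))"

lemma bezier_poly_eq_homogenized: "bezier_poly m w = homogenized m (scaled_bernstein m w)"
  by (simp add: bezier_poly_def homogenized_def coeff_scaled_bernstein mult.commute)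

text \<open>
  The factor \<open>1 + x\<close> becomes \<open>v + (1 - v) = 1\<close>, so it only raises the formal degree.
\<close>

lemma homogenized_mult_linear:
  assumes "Polynomial.degree f \<le> m"
  shows "homogenized (Suc m) ([:1, 1:] * f) = homogenized m f"
proof -
  have "homogenized (Suc m) ([:1, 1:] * f) = homogenized (Suc m) (pCons 0 f) + homogenized (Suc m) f"
    by (simp add: homogenized_def smult_add_left sum.distrib add.commute)
  also have "homogenized (Suc m) (pCons 0 f) = [:0, 1:] * homogenized m f"
    unfolding homogenized_def sum.atMost_Suc_shift sum_distrib_left
    by (simp add: mult.assoc del: sum.atMost_Suc mult_pCons_left mult_pCons_right)
  also have "homogenized (Suc m) f = [:1, -1:] * homogenized m f"
  proof -
    have "poly.coeff f (Suc m) = 0" using assms by (simp add: coeff_eq_0)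
    then show ?thesis
      unfolding homogenized_def sum_distrib_left
      by (auto simp: Suc_diff_le mult_ac simp del: mult_pCons_left mult_pCons_right intro!: sum.cong)
  qed
  also have "[:0, 1:] * homogenized m f + [:1, -1:] * homogenized m f = homogenized m f"
    by (simp flip: distrib_right)
  finally show ?thesis .
qed

lemma homogenized_mult_linear_power:
  assumes "Polynomial.degree f \<le> m"
  shows "homogenized (m + k) ([:1, 1:] ^ k * f) = homogenized m f"
proof (induction k)
  case (Suc k)
  have "Polynomial.degree ([:1, 1:] ^ k * f) \<le> m + k"
    using degree_mult_le[of "[:1, 1:] ^ k" f] degree_power_le[of "[:1, 1 :: real:]" k] assms by simp
  from homogenized_mult_linear[OF this] Suc show ?case by (simp only: power_Suc mult.assoc add_Suc_right)
qed simp

lemma degree_homogenized_le: "Polynomial.degree (homogenized m f) \<le> m"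
  unfolding homogenized_def
proof (intro degree_sum_le)
  fix i assume "i \<in> {..m}"
  then show "Polynomial.degree (Polynomial.smult (poly.coeff f i) ([:0, 1:] ^ i * [:1, -1:] ^ (m - i))) \<le> m"
    using degree_mult_le[of "[:0, 1::real:] ^ i" "[:1, -1:] ^ (m - i)"]
      degree_power_le[of "[:0, 1 :: real:]" i] degree_power_le[of "[:1, -1 :: real:]" "m - i"]
    by (intro order.trans[OF degree_smult_le]) auto
qed simp

lemma top_coeff_homogenized:
  assumes "Polynomial.degree f \<le> m"
  shows "poly.coeff (homogenized m f) m = (-1) ^ m * poly f (-1)"
proof -
  have c: "poly.coeff ([:0, 1:] ^ i * [:1, -1:] ^ (m - i)) m = (-1 :: real) ^ m * (-1) ^ i" if "i \<le> m" for i
  proof -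
    have "poly.coeff ([:0, 1:] ^ i * [:1, -1:] ^ (m - i)) m = poly.coeff ([:1, -1::real:] ^ (m - i)) (m - i)"
      using that coeff_monom_mult[of 1 i "[:1, -1::real:] ^ (m - i)" m]
      by (simp add: monom_altdef)
    also have "\<dots> = (-1) ^ (m - i)"
      using lead_coeff_power[of "[:1, -1::real:]" "m - i"] by (simp add: degree_power_eq)
    also have "\<dots> = (-1) ^ m * (-1) ^ i"
      using that by (simp flip: power_add add: minus_one_power_iff)
    finally show ?thesis .
  qed
  have "poly.coeff (homogenized m f) m = (\<Sum>i\<le>m. poly.coeff f i * ((-1) ^ m * (-1) ^ i))"
    unfolding homogenized_def coeff_sum coeff_smult by (intro sum.cong) (auto simp only: c atMost_iff)
  also have "\<dots> = (-1) ^ m * (\<Sum>i\<le>m. poly.coeff f i * (-1) ^ i)"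
    by (simp add: sum_distrib_left mult_ac)
  also have "(\<Sum>i\<le>m. poly.coeff f i * (-1) ^ i) = poly f (-1)"
    unfolding poly_altdef using assms by (intro sum.mono_neutral_right) (auto simp: coeff_eq_0)
  finally show ?thesis .
qed

text \<open>
  The point \<open>v = \<infinity>\<close> corresponds to \<open>x = -1\<close>. A factor \<open>1 + x\<close> costs one degree in \<open>v\<close>, and once
  all of them are removed the coefficient of the top power of \<open>v\<close> is, up to sign, the value at
  \<open>-1\<close>. This translates the degree condition of the C-equation into vanishing orders.
\<close>

lemma degree_bezier_poly:
  assumes nz: "scaled_bernstein m w \<noteq> 0"
  shows "Polynomial.degree (bezier_poly m w) = m - Polynomial.order (-1) (scaled_bernstein m w)"
proof -
  define f where "f = scaled_bernstein m w"
  define k where "k = Polynomial.order (-1) f"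
  obtain u where u: "f = [:1, 1:] ^ k * u" "\<not> [:1, 1:] dvd u"
    using order_decomp[of f "-1"] nz unfolding f_def k_def by auto
  have u1: "poly u (-1) \<noteq> 0" using u(2) by (simp add: poly_eq_0_iff_dvd)
  then have "Polynomial.degree f = k + Polynomial.degree u"
    unfolding u(1) by (subst degree_mult_eq) (auto simp: degree_power_eq)
  moreover have "Polynomial.degree f \<le> m" unfolding f_def by (rule degree_scaled_bernstein)
  ultimately have k: "k \<le> m" "Polynomial.degree u \<le> m - k" by auto
  have "bezier_poly m w = homogenized (m - k) u"
    using homogenized_mult_linear_power[OF k(2), of k] k(1)
    unfolding bezier_poly_eq_homogenized f_def[symmetric] u(1)[symmetric] by simp
  moreover have "Polynomial.degree (homogenized (m - k) u) = m - k"
    using top_coeff_homogenized[OF k(2)] u1 degree_homogenized_le[of "m - k" u]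
    by (intro antisym le_degree) auto
  ultimately show ?thesis by (simp add: k_def f_def)
qed

section \<open>Polynomial combinations of two quadratics\<close>

text \<open>
  Bezout for the coprime cofactors, with the multiplier of \<open>q\<close> reduced modulo \<open>p'\<close>. The degree
  bound on \<open>u\<close> follows by comparing degrees in \<open>T - q * v = p * u\<close>; since \<open>q * v\<close> has degree at
  most 3, this is where \<open>k \<ge> 2\<close> enters. Vanishing coefficients instead of a degree bound
  also cover the case \<open>p'\<close> constant, where \<open>v\<close> must be \<open>0\<close>.
\<close>

lemma linear_combination_exists:
  fixes p q h p' q' T :: "real poly"
  assumes p: "p = h * p'" and q: "q = h * q'" and cop: "coprime p' q'"
    and dp: "Polynomial.degree p = 2" and dq: "Polynomial.degree q \<le> 2" and k: "k \<ge> 2"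
    and hT: "h dvd T" and dT: "\<And>i. i \<ge> k + 2 \<Longrightarrow> poly.coeff T i = 0"
  obtains u v where "T = p * u + q * v" "\<And>i. i \<ge> k \<Longrightarrow> poly.coeff u i = 0"
    "\<And>i. i \<ge> Polynomial.degree p' \<Longrightarrow> poly.coeff v i = 0"
proof -
  have p0: "p \<noteq> 0" using dp by auto
  have p'0: "p' \<noteq> 0" "h \<noteq> 0" using p0 p by auto
  have dp': "Polynomial.degree p' \<le> 2" using dp p p'0 by (simp add: degree_mult_eq)
  obtain T' where T': "T = h * T'" using hT by blast
  obtain x y where xy: "x * p' + y * q' = 1"
    using bezout_coefficients_fst_snd[of p' q'] cop by (metis coprime_iff_gcd_eq_1)
  define v where "v = (T' * y) mod p'"
  \<comment> \<open>The part of \<open>T' * y\<close> removed from \<open>v\<close> moves over to \<open>u\<close>.\<close>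
  define u where "u = T' * x + q' * ((T' * y) div p')"
  have "p' * u + q' * v = p' * (T' * x) + q' * (((T' * y) div p') * p' + (T' * y) mod p')"
    unfolding u_def v_def by (simp only: distrib_left mult_ac add_ac)
  also have "\<dots> = T' * (x * p' + y * q')" unfolding div_mult_mod_eq
    by (simp only: distrib_left mult_ac add_ac)
  finally have "p' * u + q' * v = T'" unfolding xy by simp
  then have T: "T = p * u + q * v" unfolding p q T' by (metis distrib_left mult.assoc)
  have v: "v = 0 \<or> Polynomial.degree v < Polynomial.degree p'"
    using degree_mod_less[OF p'0(1)] unfolding v_def by blast
  show thesis
  proof (rule that[OF T])
    fix i assume "i \<ge> Polynomial.degree p'"
    then show "poly.coeff v i = 0" using v by (auto intro: coeff_eq_0)
  next
    fix i assume i: "i \<ge> k"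
    have "Polynomial.degree T \<le> k + 1" using dT by (intro degree_le) auto
    moreover have "Polynomial.degree (q * v) \<le> 3"
    proof (cases "v = 0")
      case False
      then have "Polynomial.degree v \<le> 1" using v dp' by linarith
      then show ?thesis using degree_mult_le[of q v] dq by linarith
    qed simp
    ultimately have "Polynomial.degree (T - q * v) \<le> k + 1"
      using k by (intro degree_diff_le) auto
    moreover have "T - q * v = p * u" using T by simp
    ultimately have "u = 0 \<or> Polynomial.degree u \<le> k - 1"
      using degree_mult_eq[OF p0, of u] dp by (cases "u = 0") auto
    then show "poly.coeff u i = 0" using i k by (auto intro: coeff_eq_0)
  qed
qed

text \<open>
  A solution of the homogeneous equation has \<open>p'\<close> dividing \<open>v\<close>, and \<open>v\<close> is too short for that.
\<close>

lemma linear_combination_unique: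
  fixes p q h p' q' u v :: "real poly"
  assumes p: "p = h * p'" and q: "q = h * q'" and cop: "coprime p' q'" and p0: "p \<noteq> 0"
    and z: "p * u + q * v = 0" and v: "\<And>i. i \<ge> Polynomial.degree p' \<Longrightarrow> poly.coeff v i = 0"
  shows "u = 0" "v = 0"
proof -
  have h: "h \<noteq> 0" using p p0 by auto
  have "h * (p' * u + q' * v) = 0" using z unfolding p q by (simp add: algebra_simps)
  then have z': "p' * u + q' * v = 0" using h by simp
  then have "q' * v = p' * (- u)" by (simp add: add_eq_0_iff)
  then have "p' dvd q' * v" by simp
  then have "p' dvd v" using cop by (simp add: coprime_dvd_mult_right_iff)
  show "v = 0"
  proof (rule ccontr)
    assume "v \<noteq> 0"
    then have "Polynomial.degree p' \<le> Polynomial.degree v" using \<open>p' dvd v\<close> by (simp add: dvd_imp_degree_le)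
    then show False using v[of "Polynomial.degree v"] \<open>v \<noteq> 0\<close> by simp
  qed
  then show "u = 0" using z p0 by simp
qed

text \<open>
  The resultant of \<open>l 0 + 2 * l 1 * x + l 2 * x\<^sup>2\<close> and the same quadratic for \<open>r\<close> is
  \<open>(g 0 2)\<^sup>2 - 4 * g 0 1 * g 1 2\<close>, and the two quadratics are proportional exactly if all \<open>g i j\<close>
  vanish. A single common root \<open>z\<close> gives \<open>g 0 1 = g 1 2 * z\<^sup>2\<close> and \<open>g 0 2 = - 2 * g 1 2 * z\<close>; since
  \<open>z \<noteq> 0\<close>, either all three minors vanish or none does, which explains the product in the
  condition for degree 1.
\<close>

lemma degree_gcd_quadratics:
  fixes l r :: "nat \<Rightarrow> real"
  defines "d \<equiv> Polynomial.degree (gcd (scaled_bernstein 2 l) (scaled_bernstein 2 r))"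
  defines "g \<equiv> \<lambda>i j. l i * r j - l j * r i"
  assumes l0: "l 0 \<noteq> 0" and l2: "l 2 \<noteq> 0"
  shows "d \<le> 2"
    and "d = 2 \<longleftrightarrow> g 0 1 = 0 \<and> g 1 2 = 0 \<and> g 0 2 = 0"
    and "d = 1 \<longleftrightarrow> g 0 1 * g 1 2 * g 0 2 \<noteq> 0 \<and> (g 0 2)\<^sup>2 = 4 * g 0 1 * g 1 2"
proof -
  define p where "p = scaled_bernstein 2 l"
  define q where "q = scaled_bernstein 2 r"
  define h where "h = gcd p q"
  have d: "d = Polynomial.degree h" by (simp add: d_def h_def p_def q_def)
  have p: "p = [:l 0, 2 * l 1, l 2:]" and q: "q = [:r 0, 2 * r 1, r 2:]"
    by (simp_all add: p_def q_def scaled_bernstein_2)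
  have dp: "Polynomial.degree p = 2" using l2 by (simp add: p)
  have p0: "p \<noteq> 0" using dp by auto
  have hp: "h dvd p" "h dvd q" by (simp_all add: h_def)
  have h0: "h \<noteq> 0" using hp p0 by auto
  show d2: "d \<le> 2" using dvd_imp_degree_le[OF hp(1) p0] dp d by simp
  show eq2: "d = 2 \<longleftrightarrow> g 0 1 = 0 \<and> g 1 2 = 0 \<and> g 0 2 = 0"
  proof
    assume "g 0 1 = 0 \<and> g 1 2 = 0 \<and> g 0 2 = 0"
    then have "q = Polynomial.smult (r 0 / l 0) p"
      using l0 by (simp add: p q g_def field_simps)
    then have "p dvd h" by (simp add: h_def dvd_smult)
    then show "d = 2" using dvd_imp_degree_le[OF _ h0, of p] d2 d dp by simp
  next
    assume "d = 2"
    obtain p' where p': "p = h * p'" using hp by blast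
    obtain q' where q': "q = h * q'" using hp by blast
    have "Polynomial.degree p' = 0"
      using p' p0 dp \<open>d = 2\<close> d by (auto simp: degree_mult_eq)
    then obtain \<alpha> where \<alpha>: "p' = [:\<alpha>:]" by (metis degree_eq_zeroE)
    have "Polynomial.degree q \<le> 2" unfolding q_def by (rule degree_scaled_bernstein)
    then have "Polynomial.degree q' = 0"
      using q' h0 \<open>d = 2\<close> d by (cases "q' = 0") (auto simp: degree_mult_eq)
    then obtain \<beta> where \<beta>: "q' = [:\<beta>:]" by (metis degree_eq_zeroE)
    have P: "poly.coeff p i = \<alpha> * poly.coeff h i" for i using p' \<alpha> by simp
    have Q: "poly.coeff q i = \<beta> * poly.coeff h i" for i using q' \<beta> by simp
    have "l 0 = \<alpha> * poly.coeff h 0" "l 1 = \<alpha> * (poly.coeff h 1 / 2)" "l 2 = \<alpha> * poly.coeff h 2"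
      "r 0 = \<beta> * poly.coeff h 0" "r 1 = \<beta> * (poly.coeff h 1 / 2)" "r 2 = \<beta> * poly.coeff h 2"
      using P[of 0] P[of 1] P[of 2] Q[of 0] Q[of 1] Q[of 2] by (simp_all add: p q numeral_2_eq_2)
    then show "g 0 1 = 0 \<and> g 1 2 = 0 \<and> g 0 2 = 0" unfolding g_def by (simp only:) simp
  qed
  show "d = 1 \<longleftrightarrow> g 0 1 * g 1 2 * g 0 2 \<noteq> 0 \<and> (g 0 2)\<^sup>2 = 4 * g 0 1 * g 1 2"
  proof
    assume d1: "d = 1"
    define a b where "a = poly.coeff h 0" and "b = poly.coeff h 1"
    have "h = [:a, b:]"
      using d1 d by (intro poly_eqI) (auto simp: a_def b_def coeff_pCons coeff_eq_0 split: nat.splits)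
    moreover have "b \<noteq> 0" using d1 d h0 unfolding b_def by (metis leading_coeff_0_iff)
    ultimately have h: "h = [:a, b:]" "b \<noteq> 0" by auto
    define z where "z = - a / b"
    have "poly h z = 0" using h by (simp add: z_def)
    then have "poly p z = 0" "poly q z = 0" using hp by (auto elim!: dvdE)
    then have z: "l 0 = - 2 * l 1 * z - l 2 * z\<^sup>2" "r 0 = - 2 * r 1 * z - r 2 * z\<^sup>2"
      by (simp_all add: p q power2_eq_square algebra_simps)
    have z0: "z \<noteq> 0" using z l0 by auto
    have g: "g 0 1 = g 1 2 * z\<^sup>2" "g 0 2 = - 2 * g 1 2 * z"
      unfolding g_def z by (simp_all add: algebra_simps power2_eq_square)
    have "g 1 2 \<noteq> 0" using eq2 d1 g by auto
    then show "g 0 1 * g 1 2 * g 0 2 \<noteq> 0 \<and> (g 0 2)\<^sup>2 = 4 * g 0 1 * g 1 2"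
      using z0 g by (simp add: power2_eq_square)
  next
    assume g: "g 0 1 * g 1 2 * g 0 2 \<noteq> 0 \<and> (g 0 2)\<^sup>2 = 4 * g 0 1 * g 1 2"
    \<comment> \<open>The nonzero root of \<open>l 0 * q - r 0 * p = x * (2 * g 0 1 + g 0 2 * x)\<close>.\<close>
    define z where "z = - 2 * g 0 1 / g 0 2"
    have z: "g 0 2 * z = - 2 * g 0 1" using g by (simp add: z_def)
    have "(g 0 2)\<^sup>2 * poly p z = l 0 * (g 0 2)\<^sup>2 + 2 * l 1 * g 0 2 * (g 0 2 * z) + l 2 * (g 0 2 * z)\<^sup>2"
      by (simp add: p algebra_simps power2_eq_square)
    also have "\<dots> = 4 * g 0 1 * (l 0 * g 1 2 - l 1 * g 0 2 + l 2 * g 0 1)"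
      using g unfolding z by (simp add: algebra_simps power2_eq_square)
    \<comment> \<open>The Pluecker relation between the two rows and their minors.\<close>
    also have "\<dots> = 0" by (simp add: g_def algebra_simps)
    finally have pz: "poly p z = 0" using g by simp
    have "l 0 * poly q z = r 0 * poly p z + z * (2 * g 0 1 + g 0 2 * z)"
      by (simp add: p q g_def algebra_simps)
    then have qz: "poly q z = 0" using pz z l0 by simp
    have "[:-z, 1:] dvd h" using pz qz by (simp add: h_def poly_eq_0_iff_dvd)
    then have "d \<ge> 1" using dvd_imp_degree_le[OF _ h0] d by force
    moreover have "d \<noteq> 2" using eq2 g by auto
    ultimately show "d = 1" using d2 by simp
  qed
qed

section \<open>The equations as one polynomial identity\<close>

lemma sumLR_eq_coeff:
  "sumLR n l r C X s = poly.coeff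
     (scaled_bernstein 2 l * scaled_bernstein n (\<lambda>i. C i - X (Lft i)) +
      scaled_bernstein 2 r * scaled_bernstein n (\<lambda>i. X (Rgt i) - C i)) s"
  unfolding sumLR_def coeff_add mult.commute[of "scaled_bernstein 2 _"] coeff_mult_scaled_bernstein
    sum.distrib[symmetric]
  by (intro sum.cong) (auto simp: algebra_simps)

lemma sumC_eq_coeff:
  "sumC n c C s = poly.coeff
     (scaled_bernstein (n - 1) (\<lambda>i. C (i + 1) - C i) * scaled_bernstein 4 c) s"
  unfolding sumC_def coeff_mult_scaled_bernstein
  by (intro sum.cong) (auto simp: algebra_simps)

text \<open>
  The alternating sum on the right of the equation is, up to sign, the coefficient of \<open>x ^ s\<close> in the
  series of \<open>sumC\<close> divided by \<open>1 + x\<close>. If the division is exact with quotient \<open>W\<close>, the sum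
  telescopes to a coefficient of \<open>W\<close>, and all equations together say that a polynomial is zero.
\<close>

lemma Eq_iff_coeff_eq_0:
  assumes W: "scaled_bernstein (n - 1) (\<lambda>i. C (i + 1) - C i) * scaled_bernstein 4 c = [:1, 1:] * W"
  shows "Eq n l r c C X s \<longleftrightarrow> poly.coeff
     (scaled_bernstein 2 l * scaled_bernstein n (\<lambda>i. C i - X (Lft i)) +
      scaled_bernstein 2 r * scaled_bernstein n (\<lambda>i. X (Rgt i) - C i) + W) s = 0"
proof -
  have "sumC n c C k = poly.coeff ([:1, 1:] * W) k" for k unfolding sumC_eq_coeff W ..
  then have "(\<Sum>k\<le>s. (-1) ^ k * sumC n c C k) = (-1) ^ s * poly.coeff W s"
    by (induction s) (simp_all add: algebra_simps)
  then have "(-1) ^ (s + 1) * (\<Sum>k\<le>s. (-1) ^ k * sumC n c C k) = - poly.coeff W s"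
    by (simp add: minus_one_power_iff)
  then show ?thesis unfolding Eq_def sumLR_eq_coeff by (auto simp: algebra_simps)
qed

section \<open>Consistency: the common divisor of the side weights\<close>

lemma scaled_bernstein_weight_c:
  "scaled_bernstein 4 (weight_c a b) =
     scaled_bernstein 2 (fst \<circ> a) * scaled_bernstein 2 (snd \<circ> b) -
     scaled_bernstein 2 (snd \<circ> a) * scaled_bernstein 2 (fst \<circ> b)"
proof (rule poly_eqI)
  fix k
  let ?S = "{(i, j). i \<le> 2 \<and> j \<le> 2 \<and> i + j = k} :: (nat \<times> nat) set"
  have "poly.coeff (scaled_bernstein 4 (weight_c a b)) k =
      (\<Sum>(i, j)\<in>?S. real (2 choose i) * real (2 choose j) * cross (a i) (b j))"
  proof (cases "k \<le> 4")
    case False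
    then have "?S = {}" by auto
    then show ?thesis using False by (simp only: sum.empty) (simp add: coeff_scaled_bernstein binomial_eq_0)
  qed (simp add: coeff_scaled_bernstein weight_c_def)
  also have "\<dots> = poly.coeff (scaled_bernstein 2 (fst \<circ> a) * scaled_bernstein 2 (snd \<circ> b) -
     scaled_bernstein 2 (snd \<circ> a) * scaled_bernstein 2 (fst \<circ> b)) k"
    by (simp add: coeff_mult_scaled_bernstein cross_def right_diff_distrib case_prod_unfold
        flip: sum_subtractf)
  finally show "poly.coeff (scaled_bernstein 4 (weight_c a b)) k = \<dots>" .
qed

text \<open>
  In the plane, \<open>\<langle>b, e\<rangle> a + \<langle>e, a\<rangle> b + \<langle>a, b\<rangle> e = 0\<close>. Applied to the polynomial vectors \<open>a\<close> and \<open>b\<close> and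
  a constant vector \<open>e\<close>, this writes \<open>e\<close> times the polynomial of \<open>c\<close> as a combination of those of
  \<open>l\<close> and \<open>r\<close>.
\<close>

lemma common_divisor_dvd_weight_c:
  assumes e: "e \<noteq> 0"
    and h: "h dvd scaled_bernstein 2 (weight_l b e)" "h dvd scaled_bernstein 2 (weight_r a e)"
  shows "h dvd scaled_bernstein 4 (weight_c a b)"
proof -
  define a1 a2 b1 b2 where ab: "a1 = scaled_bernstein 2 (fst \<circ> a)" "a2 = scaled_bernstein 2 (snd \<circ> a)"
    "b1 = scaled_bernstein 2 (fst \<circ> b)" "b2 = scaled_bernstein 2 (snd \<circ> b)"
  define c where "c = scaled_bernstein 4 (weight_c a b)"
  define p q where pq: "p = scaled_bernstein 2 (weight_l b e)" "q = scaled_bernstein 2 (weight_r a e)"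
  define e1 e2 where e12: "e1 = [:fst e:]" "e2 = [:snd e:]"
  have p: "p = b1 * e2 - b2 * e1"
    by (rule poly_eqI) (simp add: pq ab e12 coeff_scaled_bernstein weight_l_def cross_def algebra_simps)
  have q: "q = a2 * e1 - a1 * e2"
    by (rule poly_eqI) (simp add: pq ab e12 coeff_scaled_bernstein weight_r_def cross_def algebra_simps)
  have c: "c = a1 * b2 - a2 * b1" unfolding c_def ab by (rule scaled_bernstein_weight_c)
  have "e1 * c = - (a1 * p + b1 * q)" "e2 * c = - (a2 * p + b2 * q)"
    unfolding p q c by (simp_all add: algebra_simps)
  then have "h dvd e1 * c" "h dvd e2 * c" using h unfolding pq[symmetric] by simp_all
  then have "h dvd c" using e by (auto simp: e12 dvd_smult_iff prod_eq_iff)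
  then show ?thesis by (simp add: c_def)
qed

text \<open>
  The C-equation makes the derivative of \<open>Z\<close> along the edge drop in degree, which in the variable \<open>x\<close>
  is a root at \<open>-1\<close>. Pascal's rule is the reason.
\<close>

lemma alternating_sum_eq_difference_poly:
  assumes "n \<ge> 1"
  shows "(\<Sum>i\<le>n. (-1) ^ i * real (n choose i) * C i) =
     - poly (scaled_bernstein (n - 1) (\<lambda>i. C (i + 1) - C i)) (-1)"
proof -
  obtain m where m: "n = Suc m" using assms by (cases n) auto
  have "(\<Sum>i\<le>m. (-1) ^ Suc i * real (m choose Suc i) * C (Suc i)) + C 0 =
      (\<Sum>i\<le>Suc m. (-1) ^ i * real (m choose i) * C i)"
    by (subst sum.atMost_Suc_shift) simp
  also have "\<dots> = (\<Sum>i\<le>m. (-1) ^ i * real (m choose i) * C i)" by (simp add: binomial_eq_0)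
  finally have *: "(\<Sum>i\<le>m. (-1) ^ Suc i * real (m choose Suc i) * C (Suc i)) + C 0 =
      (\<Sum>i\<le>m. (-1) ^ i * real (m choose i) * C i)" .
  have "(\<Sum>i\<le>n. (-1) ^ i * real (n choose i) * C i) =
     C 0 + (\<Sum>i\<le>m. (-1) ^ Suc i * real (m choose Suc i) * C (Suc i)) +
       (\<Sum>i\<le>m. (-1) ^ Suc i * real (m choose i) * C (Suc i))"
    unfolding m by (subst sum.atMost_Suc_shift) (simp add: algebra_simps sum.distrib sum_subtractf sum_negf)
  also have "\<dots> = (\<Sum>i\<le>m. (-1) ^ i * real (m choose i) * C i) +
       (\<Sum>i\<le>m. (-1) ^ Suc i * real (m choose i) * C (Suc i))" using * by simp
  also have "\<dots> = - (\<Sum>i\<le>m. real (m choose i) * (C (i + 1) - C i) * (-1) ^ i)"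
    by (simp add: algebra_simps sum_subtractf sum_negf)
  finally show ?thesis by (simp add: m scaled_bernstein_def poly_sum poly_monom)
qed

text \<open>
  The equations need both the exact division by \<open>1 + x\<close> and the divisibility of the quotient by
  the gcd of the side weights. For nonzero \<open>c\<close> and \<open>D\<close>, only the order at \<open>-1\<close> matters. Let \<open>K\<close> be
  that of the gcd, so that the larger degree of \<open>l\<close> and \<open>r\<close> is \<open>2 - K\<close>. Either \<open>c\<close> has order above \<open>K\<close>, or \<open>c\<close> has
  degree \<open>4 - K\<close>, and then the degrees differ by 2 and the hypothesis supplies a root of \<open>D\<close>.
\<close>

lemma gcd_times_linear_dvd:
  fixes D :: "real poly" and l r c :: "nat \<Rightarrow> real"
  defines "p \<equiv> scaled_bernstein 2 l" and "q \<equiv> scaled_bernstein 2 r"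
  assumes p0: "p \<noteq> 0" and q0: "q \<noteq> 0"
    and hc: "gcd p q dvd scaled_bernstein 4 c"
    and D: "int (Polynomial.degree (bezier_poly 4 c)) -
         int (max (Polynomial.degree (bezier_poly 2 l)) (Polynomial.degree (bezier_poly 2 r))) = 2 \<Longrightarrow>
       poly D (-1) = 0"
  shows "[:1, 1:] * gcd p q dvd D * scaled_bernstein 4 c"
proof (cases "D * scaled_bernstein 4 c = 0")
  case False
  define ct where "ct = scaled_bernstein 4 c"
  define h where "h = gcd p q"
  define K where "K = Polynomial.order (-1) h"
  have ct0: "ct \<noteq> 0" and D0: "D \<noteq> 0" using False by (auto simp: ct_def)
  have h0: "h \<noteq> 0" using p0 by (simp add: h_def)
  obtain F where F: "D * ct = h * F" using hc unfolding ct_def h_def by (meson dvdE dvd_mult)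
  have K_le: "K \<le> Polynomial.order (-1) p" "K \<le> Polynomial.order (-1) q" "K \<le> Polynomial.order (-1) ct"
    using p0 q0 ct0 hc unfolding K_def h_def ct_def by (auto intro!: dvd_imp_order_le)
  have "[:1, 1:] ^ min (Polynomial.order (-1) p) (Polynomial.order (-1) q) dvd h"
    unfolding h_def using order_divides[of "-1" _ p] order_divides[of "-1" _ q] by simp
  then have K_min: "K = min (Polynomial.order (-1) p) (Polynomial.order (-1) q)"
    using order_divides[of "-1" _ h] h0 K_le unfolding K_def by force
  have K2: "Polynomial.order (-1) p \<le> 2" "Polynomial.order (-1) q \<le> 2" "Polynomial.order (-1) ct \<le> 4"
    using order_degree[OF p0, of "-1"] order_degree[OF q0, of "-1"] order_degree[OF ct0, of "-1"]
      degree_scaled_bernstein[of 2 l] degree_scaled_bernstein[of 2 r] degree_scaled_bernstein[of 4 c]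
    by (auto simp: p_def q_def ct_def)
  have "Polynomial.order (-1) D + Polynomial.order (-1) ct > K"
  proof (cases "Polynomial.order (-1) ct = K")
    case True
    have "int (Polynomial.degree (bezier_poly 4 c)) -
         int (max (Polynomial.degree (bezier_poly 2 l)) (Polynomial.degree (bezier_poly 2 r))) = 2"
    proof -
      have "Polynomial.degree (bezier_poly 4 c) = 4 - K"
        using degree_bezier_poly[of 4 c] ct0 True by (simp add: ct_def)
      moreover have "max (Polynomial.degree (bezier_poly 2 l)) (Polynomial.degree (bezier_poly 2 r)) = 2 - K"
        unfolding K_min p_def q_def
        by (subst degree_bezier_poly degree_bezier_poly, use p0 q0 in \<open>simp add: p_def q_def\<close>)+ simp
      moreover have "K \<le> 2" using K_le K2 by simp
      ultimately show ?thesis by simp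
    qed
    from D[OF this] have "Polynomial.order (-1) D \<noteq> 0" using D0 by (simp add: order_root)
    then show ?thesis using True by simp
  qed (use K_le in simp)
  then have "Polynomial.order (-1) (h * F) > K"
    unfolding F[symmetric] using order_mult[of D ct] False by (simp add: ct_def)
  then have "Polynomial.order (-1) F \<noteq> 0"
    using order_mult[of h F "-1"] False F unfolding K_def ct_def by simp
  then have "[:1, 1:] dvd F" using order_1[of "-1" F] by (metis dvd_power_same dvd_trans dvd_power gr0I minus_minus)
  then have "[:1, 1:] * h dvd h * F" by (simp only: mult.commute[of h] mult_dvd_mono dvd_refl)
  then show ?thesis using F by (simp add: ct_def h_def)
qed (simp only: dvd_0_right)

section \<open>Classifications of unknowns and the rank\<close>

text \<open>
  The rank is the dimension of the span of the columns, hence the size of a maximal independent set of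
  columns. Columns are indexed by position, so that independence also yields that they are distinct.
\<close>

lemma rank_eq_card_of_column_basis:
  fixes A :: "real mat"
  assumes A: "A \<in> carrier_mat N M" and J: "J \<subseteq> {..<M}"
    and indep: "\<And>a. (\<And>i. i < N \<Longrightarrow> (\<Sum>j\<in>J. a j * A $$ (i, j)) = 0) \<Longrightarrow> \<forall>j\<in>J. a j = 0"
    and span: "\<And>k. k < M \<Longrightarrow> \<exists>a. \<forall>i<N. A $$ (i, k) = (\<Sum>j\<in>J. a j * A $$ (i, j))"
  shows "vec_space.rank N A = card J"
proof -
  interpret vec_space "TYPE(real)" N .
  have finJ: "finite J" using J finite_subset by blast
  have colA: "col A j \<in> carrier_vec N" if "j < M" for j using A that by auto
  have ind: "col A j $ i = A $$ (i, j)" if "j < M" "i < N" for i j using A that by auto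
  have inj: "inj_on (col A) J"
  proof (rule inj_onI, rule ccontr)
    fix j j' assume jj: "j \<in> J" "j' \<in> J" "col A j = col A j'" "j \<noteq> j'"
    have *: "(\<Sum>x\<in>J. ((if x = j then 1 else 0) - (if x = j' then 1 else 0)) * A $$ (i, x)) = 0" if "i < N" for i
    proof -
      have "j < M" "j' < M" using jj J by auto
      then have "A $$ (i, j) = A $$ (i, j')" using ind[of j i] ind[of j' i] jj(3) that by metis
      then show ?thesis using jj finJ
        by (simp add: left_diff_distrib sum_subtractf if_distrib[of "\<lambda>x. x * _"] cong: if_cong)
    qed
    have "(if j = j then 1 else 0) - (if j = j' then 1 else 0) = (0::real)"
      using indep[of "\<lambda>x. (if x = j then 1 else 0) - (if x = j' then 1 else 0)"] * jj(1) by blast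
    then show False using jj(4) by simp
  qed
  define S where "S = col A ` J"
  have cols: "set (cols A) = col A ` {..<M}" using A by (auto simp: cols_def)
  have ScA: "set (cols A) \<subseteq> carrier_vec N" using cols colA by auto
  have S: "S \<subseteq> set (cols A)" "finite S" unfolding cols S_def using J finJ by auto
  have lc: "lincomb a S $ i = (\<Sum>j\<in>J. a (col A j) * A $$ (i, j))" if "i < N" for a i
  proof -
    have "lincomb a S $ i = (\<Sum>x\<in>S. a x * x $ i)"
      using S ScA that by (intro lincomb_index) auto
    also have "\<dots> = (\<Sum>j\<in>J. a (col A j) * col A j $ i)"
      unfolding S_def by (subst sum.reindex[OF inj]) simp
    also have "\<dots> = (\<Sum>j\<in>J. a (col A j) * A $$ (i, j))"
      using J that by (intro sum.cong) (auto simp: ind)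
    finally show ?thesis .
  qed
  have li: "lin_indpt S"
  proof (rule finite_lin_indpt2[OF S(2)])
    show "S \<subseteq> carrier_vec N" using S(1) ScA by auto
    fix a assume z: "lincomb a S = 0\<^sub>v N"
    have "(\<Sum>j\<in>J. a (col A j) * A $$ (i, j)) = 0" if "i < N" for i
      using lc[OF that, of a] z that by (simp add: module_vec_simps)
    from indep[of "\<lambda>j. a (col A j)", OF this] show "\<forall>v\<in>S. a v = 0"
      unfolding S_def by (auto simp: class_ring_simps)
  qed
  have sp: "v \<in> span S" if v: "v \<in> set (cols A)" for v
  proof -
    from v cols obtain k where k: "k < M" "v = col A k" by auto
    from span[OF k(1)] obtain a where a: "\<forall>i<N. A $$ (i, k) = (\<Sum>j\<in>J. a j * A $$ (i, j))" by blast
    \<comment> \<open>Linear combinations over a set of vectors take coefficients indexed by the vectors.\<close>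
    define a' where "a' = a \<circ> the_inv_into J (col A)"
    have "lincomb a' S = v"
    proof (rule eq_vecI)
      have d: "dim_vec (lincomb a' S) = N" using lincomb_dim[OF S(2)] S(1) ScA by blast
      then show "dim_vec (lincomb a' S) = dim_vec v" using k A by auto
      fix i assume "i < dim_vec v"
      then have i: "i < N" using k A by auto
      have "lincomb a' S $ i = (\<Sum>j\<in>J. a j * A $$ (i, j))"
        unfolding lc[OF i] a'_def by (intro sum.cong) (auto simp: the_inv_into_f_f[OF inj])
      then show "lincomb a' S $ i = v $ i" using a i k ind by auto
    qed
    then show ?thesis using S(2) unfolding span_def by (force simp: class_ring_simps)
  qed
  have "maximal S (\<lambda>T. T \<subseteq> set (cols A) \<and> lin_indpt T)"
    unfolding maximal_def
  proof (intro conjI allI impI)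
    fix T assume T: "S \<subseteq> T \<and> (T \<subseteq> set (cols A) \<and> lin_indpt T)"
    show "T = S"
    proof (rule ccontr)
      assume "T \<noteq> S"
      then obtain v where v: "v \<in> T" "v \<notin> S" using T by blast
      have "lin_dep (S \<union> {v})"
        using lin_dep_iff_in_span[of S v] sp[of v] S ScA li v T by auto
      then show False using supset_ld_is_ld[of "S \<union> {v}" T] T v by auto
    qed
  qed (use S li in auto)
  from rank_card_indpt[OF A this] show ?thesis
    unfolding S_def by (simp add: card_image[OF inj])
qed

lemma sumLR_diff:
  assumes U: "finite U" and XY: "\<And>x. x \<notin> U \<Longrightarrow> X x = Y x"
  shows "sumLR n l r C X s - sumLR n l r C Y s =
    (\<Sum>x\<in>U. (X x - Y x) * sumLR n l r (\<lambda>_. 0) (indicator {x}) s)"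
proof -
  let ?S = "{(i, j). i \<le> n \<and> j \<le> 2 \<and> i + j = s}"
  have D: "X z - Y z = (\<Sum>x\<in>U. (X x - Y x) * indicator {x} z)" for z
    using U XY by (cases "z \<in> U") (auto simp: indicator_def sum.delta if_distrib cong: if_cong)
  have term_eq: "(\<Sum>x\<in>U. (X x - Y x) * (m * (l j * (0 - indicator {x} (Lft i)) + r j * (indicator {x} (Rgt i) - 0)))) =
      m * (l j * (C i - X (Lft i)) + r j * (X (Rgt i) - C i)) -
      m * (l j * (C i - Y (Lft i)) + r j * (Y (Rgt i) - C i))" for m i j
  proof -
    have "m * (l j * (C i - X (Lft i)) + r j * (X (Rgt i) - C i)) -
      m * (l j * (C i - Y (Lft i)) + r j * (Y (Rgt i) - C i)) =
      m * (r j * (X (Rgt i) - Y (Rgt i)) - l j * (X (Lft i) - Y (Lft i)))" by (simp add: algebra_simps)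
    also have "\<dots> = (\<Sum>x\<in>U. (X x - Y x) * (m * (l j * (0 - indicator {x} (Lft i)) + r j * (indicator {x} (Rgt i) - 0))))"
      unfolding D[of "Lft i"] D[of "Rgt i"]
      by (simp add: sum_distrib_left algebra_simps sum_subtractf sum.distrib)
    finally show ?thesis by simp
  qed
  have "(\<Sum>x\<in>U. (X x - Y x) * sumLR n l r (\<lambda>_. 0) (indicator {x}) s) =
     (\<Sum>(i, j)\<in>?S. \<Sum>x\<in>U. (X x - Y x) * (real (n choose i) * real (2 choose j) *
         (l j * (0 - indicator {x} (Lft i)) + r j * (indicator {x} (Rgt i) - 0))))"
    unfolding sumLR_def sum_distrib_left case_prod_unfold by (rule sum.swap)
  also have "\<dots> = sumLR n l r C X s - sumLR n l r C Y s"
    unfolding sumLR_def sum_subtractf[symmetric] by (intro sum.cong) (auto simp only: term_eq)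
  finally show ?thesis by simp
qed

text \<open>
  The columns of the dependent unknowns form a basis of the column space. Uniqueness of the solution
  makes them independent; raising one basic value by 1 and comparing the two solutions expresses the
  column of that unknown through them. Hence all classifications have the same size, and one of them
  determines the rank.
\<close>

lemma middle_rank_eq_card_dependent:
  assumes n: "n \<ge> 4" and bd: "basic_dependent n l r c C G Bas Dep"
  shows "middle_rank n l r = card Dep"
proof -
  define E where "E x s = sumLR n l r (\<lambda>_. 0) (indicator {x}) s" for x s
  define xs where "xs = map Lft [2..<nprime n - 1] @ map Rgt [2..<nprime n - 1]"
  define J where "J = {k. k < length xs \<and> xs ! k \<in> Dep}"
  have np: "nprime n \<ge> 5" using n by (auto simp: nprime_def)
  have U: "set xs = middle_unknowns n"
    using np by (auto simp: xs_def middle_unknowns_def)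
  have dist: "distinct xs" by (auto simp: xs_def distinct_map inj_on_def)
  have len: "length xs = 2 * (nprime n - 3)" by (simp add: xs_def)
  have BD: "Bas \<union> Dep = set xs" "Bas \<inter> Dep = {}" using bd U by (auto simp: basic_dependent_def)
  have finD: "finite Dep" using BD(1) by (metis List.finite_set finite_Un)
  have ex1: "\<exists>!X. (\<forall>x. x \<notin> Dep \<longrightarrow> X x = Y x) \<and> restricted_middle n l r c C X"
    if "\<And>x. x \<notin> set xs \<Longrightarrow> Y x = G x" for Y
    using bd that unfolding basic_dependent_def U by blast
  obtain X where X: "\<And>x. x \<notin> Dep \<Longrightarrow> X x = G x" "restricted_middle n l r c C X"
    using ex1[of G] by blast
  have indep: "z x = 0" if z: "\<And>s. s \<in> {2..nprime n} \<Longrightarrow> (\<Sum>x\<in>Dep. z x * E x s) = 0" and x: "x \<in> Dep" for z x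
  proof -
    define X' where "X' x = (if x \<in> Dep then X x + z x else X x)" for x
    have diff: "sumLR n l r C X' s - sumLR n l r C X s = (\<Sum>x\<in>Dep. z x * E x s)" for s
      unfolding E_def by (subst sumLR_diff[OF finD]) (auto simp: X'_def)
    have "sumLR n l r C X' s = sumLR n l r C X s" if "s \<in> {2..nprime n}" for s
      using diff[of s] z[OF that] by simp
    then have "restricted_middle n l r c C X'"
      using X(2) by (simp add: restricted_middle_def Eq_def)
    moreover have "\<forall>x. x \<notin> Dep \<longrightarrow> X' x = G x" using X(1) by (simp add: X'_def)
    ultimately have "X' = X" using ex1[of G] X by blast
    then have "X' x = X x" by simp
    then show "z x = 0" using x by (simp add: X'_def)
  qed
  have span: "\<exists>z. \<forall>s\<in>{2..nprime n}. E y s = (\<Sum>x\<in>Dep. z x * E x s)" if y: "y \<in> set xs" for y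
  proof (cases "y \<in> Dep")
    case True
    then have "E y s = (\<Sum>x\<in>Dep. (if x = y then 1 else 0) * E x s)" for s
      using finD by (simp add: if_distrib[of "\<lambda>x. x * _"] cong: if_cong)
    then show ?thesis by (intro exI[of _ "\<lambda>x. if x = y then 1 else 0"]) blast
  next
    case False
    define Y where "Y = G(y := G y + 1)"
    have "Y x = G x" if "x \<notin> set xs" for x using y that by (auto simp: Y_def)
    then obtain X' where X': "\<And>x. x \<notin> Dep \<Longrightarrow> X' x = Y x" "restricted_middle n l r c C X'"
      using ex1[of Y] by blast
    have "E y s = (\<Sum>x\<in>Dep. (X x - X' x) * E x s)" if s: "s \<in> {2..nprime n}" for s
    proof -
      have "sumLR n l r C X' s - sumLR n l r C X s = (\<Sum>x\<in>insert y Dep. (X' x - X x) * E x s)"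
        unfolding E_def using finD X(1) X'(1) by (intro sumLR_diff) (auto simp: Y_def)
      also have "\<dots> = E y s + (\<Sum>x\<in>Dep. (X' x - X x) * E x s)"
        using False finD X(1)[of y] X'(1)[of y] by (simp add: Y_def)
      finally have "E y s + (\<Sum>x\<in>Dep. (X' x - X x) * E x s) = 0"
        using X(2) X'(2) s by (simp add: restricted_middle_def Eq_def)
      then show ?thesis by (simp add: left_diff_distrib sum_subtractf)
    qed
    then show ?thesis by (intro exI[of _ "\<lambda>x. X x - X' x"] ballI)
  qed
  have bij: "bij_betw ((!) xs) J Dep"
    unfolding bij_betw_def J_def
  proof
    show "inj_on ((!) xs) {k. k < length xs \<and> xs ! k \<in> Dep}"
      using dist by (simp add: inj_on_def nth_eq_iff_index_eq)
    have "x \<in> (!) xs ` {k. k < length xs \<and> xs ! k \<in> Dep}" if "x \<in> Dep" for x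
    proof -
      have "x \<in> set xs" using BD(1) that by blast
      then obtain k where "k < length xs" "xs ! k = x" by (auto simp: in_set_conv_nth)
      then show ?thesis using that by blast
    qed
    then show "(!) xs ` {k. k < length xs \<and> xs ! k \<in> Dep} = Dep" by blast
  qed
  have entry: "middle_matrix n l r $$ (i, k) = E (xs ! k) (i + 2)"
    if "i < nprime n - 1" "k < length xs" for i k
    using that by (simp add: middle_matrix_def E_def xs_def len[unfolded xs_def])
  have sumJ: "(\<Sum>j\<in>J. z (xs ! j) * middle_matrix n l r $$ (i, j)) = (\<Sum>x\<in>Dep. z x * E x (i + 2))"
    if "i < nprime n - 1" for i z
  proof -
    have "(\<Sum>j\<in>J. z (xs ! j) * middle_matrix n l r $$ (i, j)) = (\<Sum>j\<in>J. z (xs ! j) * E (xs ! j) (i + 2))"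
    proof (rule sum.cong)
      fix j assume "j \<in> J"
      then have "j < length xs" by (simp add: J_def)
      from entry[OF that this]
      show "z (xs ! j) * middle_matrix n l r $$ (i, j) = z (xs ! j) * E (xs ! j) (i + 2)" by (simp only:)
    qed simp
    also have "\<dots> = (\<Sum>x\<in>Dep. z x * E x (i + 2))" by (rule sum.reindex_bij_betw[OF bij])
    finally show ?thesis .
  qed
  have shift: "\<exists>i<nprime n - 1. s = i + 2" if "s \<in> {2..nprime n}" for s
    using that np by (intro exI[of _ "s - 2"]) auto
  have "vec_space.rank (nprime n - 1) (middle_matrix n l r) = card J"
  proof (rule rank_eq_card_of_column_basis)
    show "middle_matrix n l r \<in> carrier_mat (nprime n - 1) (length xs)"
      unfolding len by (simp add: middle_matrix_def)
    show "J \<subseteq> {..<length xs}" by (auto simp: J_def)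
  next
    fix a assume a: "\<And>i. i < nprime n - 1 \<Longrightarrow> (\<Sum>j\<in>J. a j * middle_matrix n l r $$ (i, j)) = 0"
    define z where "z x = a (the_inv_into J ((!) xs) x)" for x
    have za: "z (xs ! j) = a j" if "j \<in> J" for j
      using the_inv_into_f_f[OF bij_betw_imp_inj_on[OF bij] that] by (simp add: z_def)
    have "(\<Sum>x\<in>Dep. z x * E x s) = 0" if "s \<in> {2..nprime n}" for s
    proof -
      obtain i where i: "i < nprime n - 1" "s = i + 2" using shift \<open>s \<in> _\<close> by blast
      have "(\<Sum>j\<in>J. z (xs ! j) * middle_matrix n l r $$ (i, j)) = 0"
        using a[OF i(1)] za by (simp cong: sum.cong)
      then show ?thesis unfolding sumJ[OF i(1)] i(2) .
    qed
    then have "z x = 0" if "x \<in> Dep" for x using indep[of z] that by blast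
    then show "\<forall>j\<in>J. a j = 0" using za bij_betwE[OF bij] by metis
  next
    fix k assume k: "k < length xs"
    then have "xs ! k \<in> set xs" by simp
    then obtain z where z: "\<forall>s\<in>{2..nprime n}. E (xs ! k) s = (\<Sum>x\<in>Dep. z x * E x s)"
      using span by blast
    have "middle_matrix n l r $$ (i, k) = (\<Sum>j\<in>J. z (xs ! j) * middle_matrix n l r $$ (i, j))"
      if i: "i < nprime n - 1" for i
    proof -
      have "i + 2 \<in> {2..nprime n}" using i by auto
      then show ?thesis unfolding entry[OF i k] sumJ[OF i] using z by blast
    qed
    then show "\<exists>a. \<forall>i<nprime n - 1. middle_matrix n l r $$ (i, k) = (\<Sum>j\<in>J. a j * middle_matrix n l r $$ (i, j))"
      by (intro exI[of _ "\<lambda>j. z (xs ! j)"] allI impI)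
  qed
  then show ?thesis using bij_betw_same_card[OF bij] by (simp add: middle_rank_def)
qed

section \<open>A canonical classification\<close>

text \<open>
  A polynomial without root at \<open>0\<close> is coprime to \<open>x\<close>.
\<close>

lemma dvd_cancel_power_X:
  fixes h T :: "real poly"
  assumes h: "poly h 0 \<noteq> 0" and "h dvd Polynomial.monom 1 k * T"
  shows "h dvd T"
  using assms(2)
proof (induction k)
  case (Suc k)
  have "Polynomial.monom 1 (Suc k) * T = pCons 0 (Polynomial.monom 1 k * T)" by (simp add: monom_Suc)
  with Suc.prems obtain F where F: "pCons 0 (Polynomial.monom 1 k * T) = h * F" by auto
  have "poly (h * F) 0 = 0" by (simp flip: F)
  then have "[:0, 1:] dvd F" using h poly_eq_0_iff_dvd[of F 0] by simp
  then obtain F' where "F = pCons 0 F'" by auto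
  then have "pCons 0 (Polynomial.monom 1 k * T) = pCons 0 (h * F')" using F by simp
  then show ?case using Suc.IH by simp
qed (simp add: monom_0)

text \<open>
  Write \<open>p\<close>, \<open>q\<close> for the quadratics of \<open>l\<close>, \<open>r\<close>, and \<open>d\<close> for the degree of their gcd. Taking as
  dependent all left middle unknowns and the first \<open>2 - d\<close> right ones always works. For any values
  of the side coefficients the residual polynomial is a multiple of the gcd, and the outer equations,
  which contain no middle unknown, confine it to \<open>x\<^sup>2\<close> times a polynomial of degree at most
  \<open>nprime n - 2\<close>. Changing the dependent unknowns subtracts from the latter \<open>p * u + q * v\<close> with \<open>u\<close>
  of \<open>nprime n - 3\<close> and \<open>v\<close> of \<open>2 - d\<close> coefficients, and each such polynomial that is divisible
  by the gcd has exactly one representation of this kind.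
\<close>

lemma canonical_basic_dependent:
  fixes n :: nat and l r c C :: "nat \<Rightarrow> real" and W :: "real poly" and G :: "side_coeff \<Rightarrow> real"
  defines "p \<equiv> scaled_bernstein 2 l" and "q \<equiv> scaled_bernstein 2 r"
  defines "Dep \<equiv> Lft ` {2..nprime n - 2} \<union> Rgt ` {2..<4 - Polynomial.degree (gcd p q)}"
  assumes n: "n \<ge> 4" and l0: "l 0 \<noteq> 0" and l2: "l 2 \<noteq> 0"
    and W: "scaled_bernstein (n - 1) (\<lambda>i. C (i + 1) - C i) * scaled_bernstein 4 c = [:1, 1:] * W"
    and hW: "gcd p q dvd W"
    and outer: "\<And>s. s \<in> {0, 1, nprime n + 1} \<Longrightarrow> Eq n l r c C G s"
      "n \<ge> 5 \<Longrightarrow> Eq n l r c C G (nprime n + 2)"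
  shows "basic_dependent n l r c C G (middle_unknowns n - Dep) Dep"
proof -
  define h where "h = gcd p q"
  define d where "d = Polynomial.degree h"
  define Pl where "Pl X = scaled_bernstein n (\<lambda>i. C i - X (Lft i))" for X
  define Pr where "Pr X = scaled_bernstein n (\<lambda>i. X (Rgt i) - C i)" for X
  define T where "T X = p * Pl X + q * Pr X + W" for X
  have Eq_iff: "Eq n l r c C X s \<longleftrightarrow> poly.coeff (T X) s = 0" for X s
    unfolding Eq_iff_coeff_eq_0[OF W] T_def p_def q_def Pl_def Pr_def ..
  have np: "nprime n \<ge> 5" "nprime n - 2 \<le> n" "n = 4 \<and> nprime n = 5 \<or> n \<ge> 5 \<and> nprime n = n"
    using n by (auto simp: nprime_def)
  have dp: "Polynomial.degree p = 2" using l2 by (simp add: p_def scaled_bernstein_2)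
  have dq: "Polynomial.degree q \<le> 2" unfolding q_def by (rule degree_scaled_bernstein)
  have p0: "p \<noteq> 0" using dp by auto
  have hp: "h dvd p" "h dvd q" by (simp_all add: h_def)
  have d2: "d \<le> 2" using dvd_imp_degree_le[OF hp(1) p0] dp d_def by simp
  have h0: "poly h 0 \<noteq> 0"
    using hp(1) l0 by (auto simp: p_def scaled_bernstein_2 elim!: dvdE dest: arg_cong[of _ _ "\<lambda>p. poly p 0"])
  have "gcd p q \<noteq> 0" using p0 by simp
  from gcd_coprime_exists[OF this] obtain p' q' where
    "p = p' * h" "q = q' * h" "coprime p' q'" unfolding h_def by blast
  then have pq': "p = h * p'" "q = h * q'" "coprime p' q'" by (simp_all only: mult.commute)
  have dp': "Polynomial.degree p' = 2 - d"
    using dp p0 unfolding pq'(1) d_def by (auto simp: degree_mult_eq)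
  have Dep: "Dep = Lft ` {2..nprime n - 2} \<union> Rgt ` {2..<4 - d}"
    by (simp add: Dep_def d_def h_def)
  have DepU: "Dep \<subseteq> middle_unknowns n" using np unfolding Dep middle_unknowns_def by auto
  \<comment> \<open>For \<open>n = 4\<close> the index \<open>nprime n + 2\<close> exceeds the degree \<open>n + 2\<close> of the residual, while for
     \<open>n \<ge> 5\<close> it is the top index and carries an equation.\<close>
  have outer0: "poly.coeff (T Y) s = 0"
    if Y: "\<And>x. x \<notin> middle_unknowns n \<Longrightarrow> Y x = G x" and s: "s < 2 \<or> s > nprime n" for Y s
  proof (cases "s \<le> n + 2")
    case True
    have "sumLR n l r C Y s = sumLR n l r C G s"
      unfolding sumLR_def
    proof (rule sum.cong)
      fix x assume "x \<in> {(i, j). i \<le> n \<and> j \<le> 2 \<and> i + j = s}"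
      then have "fst x \<notin> {2..nprime n - 2}" using s np by auto
      then have "Lft (fst x) \<notin> middle_unknowns n" "Rgt (fst x) \<notin> middle_unknowns n"
        by (auto simp: middle_unknowns_def)
      then show "(case x of (i, j) \<Rightarrow> real (n choose i) * real (2 choose j) *
             (l j * (C i - Y (Lft i)) + r j * (Y (Rgt i) - C i))) =
           (case x of (i, j) \<Rightarrow> real (n choose i) * real (2 choose j) *
             (l j * (C i - G (Lft i)) + r j * (G (Rgt i) - C i)))"
        using Y by (simp add: case_prod_unfold)
    qed simp
    moreover have "s \<in> {0, 1, nprime n + 1} \<or> n \<ge> 5 \<and> s = nprime n + 2" using True s np(3) by auto
    then have "Eq n l r c C G s" using outer by blast
    ultimately have "Eq n l r c C Y s" by (simp add: Eq_def)
    then show ?thesis by (simp add: Eq_iff)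
  next
    case False
    have "Polynomial.degree ([:1, 1:] * W) \<le> n + 3"
      unfolding W[symmetric] using n
      by (intro order.trans[OF degree_mult_le] order.trans[OF add_mono[OF degree_scaled_bernstein degree_scaled_bernstein]]) auto
    then have "Polynomial.degree W \<le> n + 2" by (cases "W = 0") (simp_all add: degree_mult_eq del: mult_pCons_left)
    moreover have "Polynomial.degree (p * Pl Y) \<le> n + 2"
      using degree_mult_le[of p "Pl Y"] dp degree_scaled_bernstein[of n "\<lambda>i. C i - Y (Lft i)"]
      unfolding Pl_def by linarith
    moreover have "Polynomial.degree (q * Pr Y) \<le> n + 2"
      using degree_mult_le[of q "Pr Y"] dq degree_scaled_bernstein[of n "\<lambda>i. Y (Rgt i) - C i"]
      unfolding Pr_def by linarith
    ultimately have "Polynomial.degree (T Y) \<le> n + 2" unfolding T_def by (intro degree_add_le)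
    then show ?thesis using False by (intro coeff_eq_0) simp
  qed
  have hT: "h dvd T X" for X using hp hW unfolding T_def h_def[symmetric] by simp
  show ?thesis
    unfolding basic_dependent_def
  proof (intro conjI allI impI ex_ex1I)
    show "middle_unknowns n - Dep \<union> Dep = middle_unknowns n" using DepU by auto
  next
    fix Y :: "side_coeff \<Rightarrow> real" assume Y: "\<forall>x. x \<notin> middle_unknowns n \<longrightarrow> Y x = G x"
    have "Polynomial.monom 1 2 dvd T Y"
      unfolding monom_1_dvd_iff' using outer0[of Y] Y by auto
    then obtain T' where T': "T Y = Polynomial.monom 1 2 * T'" by blast
    have cT': "poly.coeff T' i = poly.coeff (T Y) (i + 2)" for i
      unfolding T' by (simp add: coeff_monom_mult)
    have "h dvd T'" using dvd_cancel_power_X[OF h0] hT[of Y] unfolding T' by blast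
    moreover have "poly.coeff T' i = 0" if "i \<ge> (nprime n - 3) + 2" for i
      unfolding cT' using outer0[of Y] Y that np(1) by auto
    moreover have "nprime n - 3 \<ge> 2" using np by simp
    ultimately obtain u v where uv: "T' = p * u + q * v" "\<And>i. i \<ge> nprime n - 3 \<Longrightarrow> poly.coeff u i = 0"
      "\<And>i. i \<ge> 2 - d \<Longrightarrow> poly.coeff v i = 0"
      using linear_combination_exists[OF pq' dp dq, of "nprime n - 3" T'] dp' by metis
    \<comment> \<open>Dividing by the binomial coefficients undoes the scaling of the unknowns.\<close>
    define X where "X x = (case x of
        Lft t \<Rightarrow> if t \<in> {2..nprime n - 2} then Y (Lft t) + poly.coeff u (t - 2) / real (n choose t) else Y (Lft t)
      | Rgt t \<Rightarrow> if t \<in> {2..<4 - d} then Y (Rgt t) - poly.coeff v (t - 2) / real (n choose t) else Y (Rgt t))" for x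
    have PlX: "Pl X = Pl Y - Polynomial.monom 1 2 * u"
    proof (rule poly_eqI)
      fix t
      show "poly.coeff (Pl X) t = poly.coeff (Pl Y - Polynomial.monom 1 2 * u) t"
      proof (cases "t \<in> {2..nprime n - 2}")
        case True
        then have "X (Lft t) = Y (Lft t) + poly.coeff u (t - 2) / real (n choose t)" by (simp add: X_def)
        moreover have "real (n choose t) \<noteq> 0" using True np(2) by simp
        ultimately show ?thesis using True
          by (simp add: Pl_def coeff_scaled_bernstein coeff_monom_mult right_diff_distrib distrib_left)
      next
        case False
        then have "X (Lft t) = Y (Lft t)" by (auto simp: X_def)
        moreover have "t < 2 \<or> poly.coeff u (t - 2) = 0" using False uv(2)[of "t - 2"] by (cases "t < 2") auto
        ultimately show ?thesis by (auto simp: Pl_def coeff_scaled_bernstein coeff_monom_mult)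
      qed
    qed
    have PrX: "Pr X = Pr Y - Polynomial.monom 1 2 * v"
    proof (rule poly_eqI)
      fix t
      show "poly.coeff (Pr X) t = poly.coeff (Pr Y - Polynomial.monom 1 2 * v) t"
      proof (cases "t \<in> {2..<4 - d}")
        case True
        then have "X (Rgt t) = Y (Rgt t) - poly.coeff v (t - 2) / real (n choose t)" by (simp add: X_def)
        moreover have "t \<le> n" using True n by auto
        then have "real (n choose t) \<noteq> 0" by simp
        ultimately show ?thesis using True
          by (simp add: Pr_def coeff_scaled_bernstein coeff_monom_mult right_diff_distrib)
      next
        case False
        then have "X (Rgt t) = Y (Rgt t)" by (auto simp: X_def)
        moreover have "t < 2 \<or> poly.coeff v (t - 2) = 0" using False uv(3)[of "t - 2"] by (cases "t < 2") auto
        ultimately show ?thesis by (auto simp: Pr_def coeff_scaled_bernstein coeff_monom_mult)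
      qed
    qed
    have "T X = T Y - Polynomial.monom 1 2 * T'" unfolding T_def uv(1) PlX PrX by (simp add: algebra_simps)
    then have "T X = 0" using T' by simp
    then have "restricted_middle n l r c C X" by (simp add: restricted_middle_def Eq_iff)
    moreover have "\<forall>x. x \<notin> Dep \<longrightarrow> X x = Y x" unfolding Dep X_def by (auto split: side_coeff.splits)
    ultimately show "\<exists>X. (\<forall>x. x \<notin> Dep \<longrightarrow> X x = Y x) \<and> restricted_middle n l r c C X" by blast
  next
    fix Y X X' :: "side_coeff \<Rightarrow> real"
    assume Y: "\<forall>x. x \<notin> middle_unknowns n \<longrightarrow> Y x = G x"
      and X: "(\<forall>x. x \<notin> Dep \<longrightarrow> X x = Y x) \<and> restricted_middle n l r c C X"
      and X': "(\<forall>x. x \<notin> Dep \<longrightarrow> X' x = Y x) \<and> restricted_middle n l r c C X'"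
    have T0: "T Z = 0" if Z: "(\<forall>x. x \<notin> Dep \<longrightarrow> Z x = Y x) \<and> restricted_middle n l r c C Z" for Z
    proof (rule poly_eqI)
      fix s
      have "Z x = G x" if "x \<notin> middle_unknowns n" for x using Z Y DepU that by auto
      then show "poly.coeff (T Z) s = poly.coeff 0 s"
        using outer0[of Z s] Z by (cases "s < 2 \<or> s > nprime n") (auto simp: restricted_middle_def Eq_iff)
    qed
    have agree: "X (Lft t) = X' (Lft t)" if "t \<notin> {2..nprime n - 2}" for t
    proof -
      have "Lft t \<notin> Dep" using that unfolding Dep by auto
      then show ?thesis using X X' by simp
    qed
    have agree': "X (Rgt t) = X' (Rgt t)" if "t \<notin> {2..<4 - d}" for t
    proof -
      have "Rgt t \<notin> Dep" using that unfolding Dep by auto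
      then show ?thesis using X X' by simp
    qed
    have cl: "poly.coeff (Pl X - Pl X') t = real (n choose t) * (X' (Lft t) - X (Lft t))" for t
      unfolding Pl_def by (simp add: coeff_scaled_bernstein algebra_simps)
    have cr: "poly.coeff (Pr X - Pr X') t = real (n choose t) * (X (Rgt t) - X' (Rgt t))" for t
      unfolding Pr_def by (simp add: coeff_scaled_bernstein algebra_simps)
    have "Polynomial.monom 1 2 dvd Pl X - Pl X'" unfolding monom_1_dvd_iff' cl using agree by auto
    then obtain u where u: "Pl X - Pl X' = Polynomial.monom 1 2 * u" by blast
    have "Polynomial.monom 1 2 dvd Pr X - Pr X'" unfolding monom_1_dvd_iff' cr using agree' by auto
    then obtain v where v: "Pr X - Pr X' = Polynomial.monom 1 2 * v" by blast
    have "Polynomial.monom 1 2 * (p * u + q * v) = p * (Pl X - Pl X') + q * (Pr X - Pr X')"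
      unfolding u v by (simp add: algebra_simps)
    also have "\<dots> = T X - T X'" unfolding T_def by (simp add: algebra_simps)
    also have "\<dots> = 0" using T0 X X' by simp
    finally have "p * u + q * v = 0" by simp
    moreover have "poly.coeff v i = 0" if "i \<ge> Polynomial.degree p'" for i
    proof -
      have "poly.coeff v i = poly.coeff (Pr X - Pr X') (i + 2)" unfolding v by (simp add: coeff_monom_mult)
      then show ?thesis unfolding cr using agree'[of "i + 2"] that dp' d2 by simp
    qed
    ultimately have "u = 0" "v = 0" using linear_combination_unique[OF pq' p0] by blast+
    then have "Pl X - Pl X' = 0" "Pr X - Pr X' = 0" using u v by simp_all
    then have z: "real (n choose t) * (X' (Lft t) - X (Lft t)) = 0"
      "real (n choose t) * (X (Rgt t) - X' (Rgt t)) = 0" for t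
      using cl[of t] cr[of t] by simp_all
    show "X = X'"
    proof
      fix x show "X x = X' x"
      proof (cases x)
        case (Lft t)
        then show ?thesis using z(1)[of t] agree[of t] np by (cases "t \<le> n") auto
      next
        case (Rgt t)
        then show ?thesis using z(2)[of t] agree'[of t] n by (cases "t \<le> n") auto
      qed
    qed
  qed auto
qed

section \<open>Proportional weights\<close>

text \<open>
  If \<open>r\<close> is proportional to \<open>l\<close>, moving \<open>(L\<^sub>i, R\<^sub>i)\<close> in the direction \<open>(r 0, l 0)\<close> changes no equation.
  So no pair lies wholly among the dependent unknowns, and there are as many of them as pairs.
\<close>

lemma proportional_weights_split_pairs:
  assumes n: "n \<ge> 4" and l0: "l 0 \<noteq> 0"
    and proportional: "\<And>j. j \<le> 2 \<Longrightarrow> l 0 * r j = l j * r 0"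
    and bd: "basic_dependent n l r c C G Bas Dep" and card: "card Dep = nprime n - 3"
    and t: "t \<in> {2..nprime n - 2}"
  shows "Lft t \<in> Bas \<and> Rgt t \<in> Dep \<or> Lft t \<in> Dep \<and> Rgt t \<in> Bas"
proof -
  define U where "U = middle_unknowns n"
  have BD: "Bas \<union> Dep = U" "Bas \<inter> Dep = {}" using bd by (auto simp: basic_dependent_def U_def)
  define ind where "ind x = (case x of Lft t \<Rightarrow> t | Rgt t \<Rightarrow> t)" for x
  have U: "x \<in> U \<longleftrightarrow> ind x \<in> {2..nprime n - 2}" for x
    unfolding U_def middle_unknowns_def ind_def by (cases x) auto
  have not_both: "\<not> (Lft i \<in> Dep \<and> Rgt i \<in> Dep)" for i
  proof
    assume both: "Lft i \<in> Dep \<and> Rgt i \<in> Dep"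
    have ex1: "\<exists>!X. (\<forall>x. x \<notin> Dep \<longrightarrow> X x = G x) \<and> restricted_middle n l r c C X"
      using bd unfolding basic_dependent_def by blast
    then obtain X where X: "\<forall>x. x \<notin> Dep \<longrightarrow> X x = G x" "restricted_middle n l r c C X" by blast
    define X' where "X' = X(Lft i := X (Lft i) + r 0, Rgt i := X (Rgt i) + l 0)"
    have "sumLR n l r C X' s = sumLR n l r C X s" for s
      unfolding sumLR_def
    proof (rule sum.cong)
      fix x assume "x \<in> {(i, j). i \<le> n \<and> j \<le> 2 \<and> i + j = s}"
      then obtain k j where x: "x = (k, j)" "j \<le> 2" by auto
      have "l j * (C k - X' (Lft k)) + r j * (X' (Rgt k) - C k) =
          l j * (C k - X (Lft k)) + r j * (X (Rgt k) - C k)"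
        using proportional[OF x(2)] by (simp add: X'_def algebra_simps)
      then show "(case x of (i, j) \<Rightarrow> real (n choose i) * real (2 choose j) *
             (l j * (C i - X' (Lft i)) + r j * (X' (Rgt i) - C i))) =
           (case x of (i, j) \<Rightarrow> real (n choose i) * real (2 choose j) *
             (l j * (C i - X (Lft i)) + r j * (X (Rgt i) - C i)))" using x by simp
    qed simp
    then have "restricted_middle n l r c C X'" using X(2) by (simp add: restricted_middle_def Eq_def)
    moreover have "\<forall>x. x \<notin> Dep \<longrightarrow> X' x = G x" using X(1) both by (auto simp: X'_def)
    ultimately have "X' = X" using ex1 X by blast
    then have "X' (Rgt i) = X (Rgt i)" by simp
    then show False using l0 by (simp add: X'_def)
  qed
  have inj: "inj_on ind Dep"
  proof (rule inj_onI)
    fix x y assume "x \<in> Dep" "y \<in> Dep" "ind x = ind y"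
    then show "x = y" using not_both[of "ind x"] by (cases x; cases y) (auto simp: ind_def)
  qed
  have "ind ` Dep \<subseteq> {2..nprime n - 2}"
    using BD(1) U by blast
  moreover have "card (ind ` Dep) = card {2..nprime n - 2}"
    using card card_image[OF inj] n by (simp add: nprime_def)
  ultimately have "ind ` Dep = {2..nprime n - 2}" by (intro card_subset_eq) auto
  then have "t \<in> ind ` Dep" using t by simp
  then obtain x where "x \<in> Dep" "ind x = t" by auto
  then have "Lft t \<in> Dep \<or> Rgt t \<in> Dep" by (cases x) (auto simp: ind_def)
  moreover have "Lft t \<in> Bas \<union> Dep" "Rgt t \<in> Bas \<union> Dep" using t unfolding BD(1) U by (simp_all add: ind_def)
  ultimately show ?thesis using not_both[of t] BD(2) by blast
qed

section \<open>The geometric input and the classification theorem\<close>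

text \<open>
  Both boundary curves through the corner \<open>D\<close> are explicit: the edge from \<open>A\<close> to \<open>D\<close> is the
  straight segment at constant speed, and the outer edge is the cubic with control points
  \<open>D, E, F, C\<close>.
\<close>

lemma jacobian_bicubic_patch_corner:
  "jacobian (bicubic_patch A B C D E F) 0 1 = cross (3 *\<^sub>R (E - D)) (D - A)"
proof -
  have "bicubic_patch A B C D E F x 1 =
      (1 - x) ^ 3 *\<^sub>R D + (3 * x * (1 - x)\<^sup>2) *\<^sub>R E + (3 * x\<^sup>2 * (1 - x)) *\<^sub>R F + x ^ 3 *\<^sub>R C" for x
    by (simp add: bicubic_patch_def bicubic_net_def Bernstein_def numeral_3_eq_3 numeral_2_eq_2 binomial_Suc_Suc)
  then have u: "vector_derivative (\<lambda>x. bicubic_patch A B C D E F x 1) (at 0) = 3 *\<^sub>R (E - D)"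
    by (intro vector_derivative_at)
       (auto intro!: derivative_eq_intros simp: scaleR_diff_right)
  have "bicubic_patch A B C D E F 0 y = (1 - y) *\<^sub>R A + y *\<^sub>R D" for y
  proof -
    have "bicubic_patch A B C D E F 0 y = (1 - y) ^ 3 *\<^sub>R A + (3 * y * (1 - y)\<^sup>2) *\<^sub>R ((2/3) *\<^sub>R A + (1/3) *\<^sub>R D)
       + (3 * y\<^sup>2 * (1 - y)) *\<^sub>R ((1/3) *\<^sub>R A + (2/3) *\<^sub>R D) + y ^ 3 *\<^sub>R D"
      by (simp add: bicubic_patch_def bicubic_net_def bilinear_map_def Bernstein_def numeral_3_eq_3 numeral_2_eq_2)
    also have "\<dots> = (1 - y) *\<^sub>R A + y *\<^sub>R D"
      by (simp add: prod_eq_iff algebra_simps power2_eq_square power3_eq_cube)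
    finally show ?thesis .
  qed
  then have v: "vector_derivative (\<lambda>y. bicubic_patch A B C D E F 0 y) (at 1) = D - A"
    by (intro vector_derivative_at) (auto intro!: derivative_eq_intros)
  show ?thesis unfolding jacobian_def u v ..
qed

theorem theorem9:
  fixes n :: nat
    and \<gamma> \<gamma>' \<rho> \<rho>' lam lam' T\<rho> F\<rho> Tlam Elam :: point
    and a b :: "nat \<Rightarrow> point"
    and l r c :: "nat \<Rightarrow> real"
    and g :: "nat \<Rightarrow> nat \<Rightarrow> real"
    and C :: "nat \<Rightarrow> real"
    and G :: "side_coeff \<Rightarrow> real"
  assumes n: "n \<ge> 4"
    and right_convex: "strictly_convex_quad \<gamma> \<rho> \<rho>' \<gamma>'"
    and left_convex: "strictly_convex_quad \<gamma> lam lam' \<gamma>'"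
    and right_side: "cross (\<gamma>' - \<gamma>) (\<rho> - \<gamma>) < 0"
    and left_side: "cross (\<gamma>' - \<gamma>) (lam - \<gamma>) > 0"
    and G1_nonzero: "\<gamma>' - Tlam \<noteq> 0" "T\<rho> - \<gamma>' \<noteq> 0"
    and G1_direction: "\<exists>k>0. T\<rho> - \<gamma>' = k *\<^sub>R (\<gamma>' - Tlam)"
    and right_regular: "regular_patch (bicubic_patch \<gamma> \<rho> \<rho>' \<gamma>' T\<rho> F\<rho>)"
    and left_regular: "regular_patch (bicubic_patch lam \<gamma> \<gamma>' lam' Elam Tlam)"
    and a: "a = left_deriv \<gamma> \<gamma>' lam lam' Tlam"
    and b: "b = right_deriv \<gamma> \<gamma>' \<rho> \<rho>' T\<rho>"
    and l: "l = weight_l b (\<gamma>' - \<gamma>)"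
    and r: "r = weight_r a (\<gamma>' - \<gamma>)"
    and c: "c = weight_c a b"
    and g: "\<And>i j. g i j = l i * r j - l j * r i"
    and Eq_bottom: "Eq n l r c C G 0" "Eq n l r c C G 1"
    and Eq_top: "Eq n l r c C G (nprime n + 1)"
    and Eq_top2: "n \<ge> 5 \<Longrightarrow> Eq n l r c C G (nprime n + 2)"
    and C_equation:
      "int (degree (bezier_poly 4 c)) -
         int (max (degree (bezier_poly 2 l)) (degree (bezier_poly 2 r))) = 2 \<Longrightarrow>
       (\<Sum>i\<le>n. (-1) ^ i * real (n choose i) * C i) = 0"
  shows
    "let case1 = (g 0 1 * g 1 2 * g 0 2 \<noteq> 0 \<and> (g 0 2)\<^sup>2 = 4 * g 0 1 * g 1 2);
         case2 = (g 0 1 = 0 \<and> g 1 2 = 0 \<and> g 0 2 = 0)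
     in
      (case1 \<longrightarrow>
         middle_rank n l r = nprime n - 2 \<and>
         (\<exists>Bas Dep. basic_dependent n l r c C G Bas Dep) \<and>
         (\<forall>Bas Dep. basic_dependent n l r c C G Bas Dep \<longrightarrow>
            card Bas = nprime n - 4 \<and> card Dep = nprime n - 2)) \<and>
      (case2 \<longrightarrow>
         middle_rank n l r = nprime n - 3 \<and>
         (\<exists>Bas Dep. basic_dependent n l r c C G Bas Dep) \<and>
         (\<forall>Bas Dep. basic_dependent n l r c C G Bas Dep \<longrightarrow>
            card Bas = nprime n - 3 \<and> card Dep = nprime n - 3 \<and>
            (\<forall>t\<in>{2..nprime n - 2}.
               Lft t \<in> Bas \<and> Rgt t \<in> Dep \<or> Lft t \<in> Dep \<and> Rgt t \<in> Bas))) \<and>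
      (\<not> case1 \<and> \<not> case2 \<longrightarrow>
         middle_rank n l r = nprime n - 1 \<and>
         (\<exists>Bas Dep. basic_dependent n l r c C G Bas Dep) \<and>
         (\<forall>Bas Dep. basic_dependent n l r c C G Bas Dep \<longrightarrow>
            card Bas = nprime n - 5 \<and> card Dep = nprime n - 1))"
proof -
  define p where "p = scaled_bernstein 2 l"
  define q where "q = scaled_bernstein 2 r"
  define d where "d = Polynomial.degree (gcd p q)"
  have l0: "l 0 > 0" using right_side by (simp add: l b weight_l_def right_deriv_def cross_def algebra_simps)
  have r0: "r 0 < 0" using left_side by (simp add: r a weight_r_def left_deriv_def cross_def algebra_simps)
  have "l 2 = jacobian (bicubic_patch \<gamma> \<rho> \<rho>' \<gamma>' T\<rho> F\<rho>) 0 1"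
    by (simp add: jacobian_bicubic_patch_corner l b weight_l_def right_deriv_def)
  then have l2: "l 2 \<noteq> 0" using right_regular by (simp add: regular_patch_def)
  have e: "\<gamma>' - \<gamma> \<noteq> 0" using l0 by (auto simp: l weight_l_def cross_def)
  have p0: "p \<noteq> 0" and q0: "q \<noteq> 0" using l0 r0 by (simp_all add: p_def q_def scaled_bernstein_2)
  have "gcd p q dvd scaled_bernstein 4 c"
    unfolding c p_def q_def l r by (rule common_divisor_dvd_weight_c[OF e]) simp_all
  moreover have "poly (scaled_bernstein (n - 1) (\<lambda>i. C (i + 1) - C i)) (-1) = 0"
    if "int (Polynomial.degree (bezier_poly 4 c)) -
         int (max (Polynomial.degree (bezier_poly 2 l)) (Polynomial.degree (bezier_poly 2 r))) = 2"
    using alternating_sum_eq_difference_poly[of n C] C_equation[OF that] n by simp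
  ultimately have "[:1, 1:] * gcd p q dvd
      scaled_bernstein (n - 1) (\<lambda>i. C (i + 1) - C i) * scaled_bernstein 4 c"
    using gcd_times_linear_dvd[of l r c] p0 q0 unfolding p_def q_def by blast
  then obtain V where V: "scaled_bernstein (n - 1) (\<lambda>i. C (i + 1) - C i) * scaled_bernstein 4 c =
      [:1, 1:] * (gcd p q * V)" unfolding dvd_def mult.assoc by blast
  define Dep0 where "Dep0 = Lft ` {2..nprime n - 2} \<union> Rgt ` {2..<4 - d}"
  have bd0: "basic_dependent n l r c C G (middle_unknowns n - Dep0) Dep0"
    unfolding Dep0_def d_def p_def q_def
  proof (rule canonical_basic_dependent)
    show "scaled_bernstein (n - 1) (\<lambda>i. C (i + 1) - C i) * scaled_bernstein 4 c =
      [:1, 1:] * (gcd p q * V)" by (rule V)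
    show "Eq n l r c C G s" if "s \<in> {0, 1, nprime n + 1}" for s
      using that Eq_bottom Eq_top by blast
  qed (use n l0 l2 Eq_top2 in \<open>simp_all add: p_def q_def\<close>)
  have np: "nprime n \<ge> 5" using n by (auto simp: nprime_def)
  have d: "d \<le> 2" "d = 2 \<longleftrightarrow> g 0 1 = 0 \<and> g 1 2 = 0 \<and> g 0 2 = 0"
    "d = 1 \<longleftrightarrow> g 0 1 * g 1 2 * g 0 2 \<noteq> 0 \<and> (g 0 2)\<^sup>2 = 4 * g 0 1 * g 1 2"
    using degree_gcd_quadratics[of l r] l0 l2 unfolding d_def p_def q_def g by simp_all
  have "card Dep0 = (nprime n - 3) + (2 - d)"
    unfolding Dep0_def using np by (subst card_Un_disjoint) (auto simp: card_image inj_on_def)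
  then have rank: "middle_rank n l r = nprime n - 1 - d"
    using middle_rank_eq_card_dependent[OF n bd0] np d(1) by simp
  have card_U: "card (middle_unknowns n) = 2 * (nprime n - 3)"
    unfolding middle_unknowns_def using np by (subst card_Un_disjoint) (auto simp: card_image inj_on_def)
  have card: "card Dep = nprime n - 1 - d \<and> card Bas = nprime n - 5 + d"
    if bd: "basic_dependent n l r c C G Bas Dep" for Bas Dep
  proof -
    have "card Dep = nprime n - 1 - d" using middle_rank_eq_card_dependent[OF n bd] rank by simp
    moreover have "Bas \<union> Dep = middle_unknowns n" "Bas \<inter> Dep = {}"
      using bd by (simp_all add: basic_dependent_def)
    moreover have "finite (middle_unknowns n)" by (simp add: middle_unknowns_def)
    ultimately have "card Bas + card Dep = 2 * (nprime n - 3)"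
      using card_Un_disjoint[of Bas Dep] card_U by (metis finite_Un)
    with \<open>card Dep = _\<close> show ?thesis using np d(1) by auto
  qed
  have pairs: "Lft t \<in> Bas \<and> Rgt t \<in> Dep \<or> Lft t \<in> Dep \<and> Rgt t \<in> Bas"
    if "d = 2" "basic_dependent n l r c C G Bas Dep" "t \<in> {2..nprime n - 2}" for Bas Dep t
  proof (rule proportional_weights_split_pairs[OF n _ _ that(2) _ that(3)])
    show "l 0 \<noteq> 0" using l0 by simp
    show "l 0 * r j = l j * r 0" if "j \<le> 2" for j
    proof -
      have "j = 0 \<or> j = 1 \<or> j = 2" using that by auto
      then show ?thesis using d(2) \<open>d = 2\<close> unfolding g by auto
    qed
    show "card Dep = nprime n - 3" using card[OF that(2)] that(1) by simp
  qed
  have ex: "\<exists>Bas Dep. basic_dependent n l r c C G Bas Dep" using bd0 by blast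
  consider "d = 0" | "d = 1" | "d = 2" using d(1) by linarith
  then show ?thesis
  proof cases
    case 1
    then show ?thesis using d(2,3) rank card ex unfolding Let_def by auto
  next
    case 2
    then have "nprime n - 1 - d = nprime n - 2" "nprime n - 5 + d = nprime n - 4" using np by auto
    then show ?thesis using d(2,3) rank card ex 2 unfolding Let_def by auto
  next
    case 3
    then have "nprime n - 1 - d = nprime n - 3" "nprime n - 5 + d = nprime n - 3" using np by auto
    then show ?thesis using d(2,3) rank card ex pairs 3 unfolding Let_def by auto
  qed
qed

end
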